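(* Let $(M,p)$ be a projective manifold of dimension $n\ge 2$. For odd positive integers $k$, if the form $p_k$ is not identically zero, then there is no Levi-Civita connection (of a pseudo-Riemannian metric on $M$) in $p$.
   Context: A projective manifold $(M^n,p)$, $n\ge2$, is a smooth manifold with an equivalence class $p$ of torsion-free affine connections, where $\nabla\sim\widehat\nabla$ iff there is a 1-form $\Upsilon_a$ with $\widehat\nabla_aY^b=\nabla_aY^b+\Upsilon_aY^b+\Upsilon_cY^c\delta_a^b$. For $\nabla\in p$ with curvature $(\nabla_a\nabla_b-\nabla_b\nabla_a)v^c=R_{ab}{}^c{}_dv^d$, the projective Weyl tensor $W_{ab}{}^c{}_d$ is the completely trace-free tensor in the unique decomposition $R_{ab}{}^c{}_d=W_{ab}{}^c{}_d+2\delta^c_{[a}P_{b]d}+\beta_{ab}\delta^c_d$, $\beta_{ab}=-2P_{[ab]}$; it depends only on $p$. The $2k$-form $p_k$ on $(M,p)$ is $(p_k)_{a_1\cdots a_{2k}}=W_{a_1a_2}{}^{c_1}{}_{c_2}W_{a_3a_4}{}^{c_2}{}_{c_3}\cdots W_{a_{2k-1}a_{2k}}{}^{c_k}{}_{c_1}$ with $a_1,\dots,a_{2k}$ skewed over; equivalently it is given by the same formula with $W$ replaced by the curvature $R$ of any connection in $p$ with symmetric Ricci tensor. Pseudo-Riemannian metrics may have any signature. *)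

theory Defs
  imports "HOL-Analysis.Analysis"
begin

section \<open>Smooth maps between Euclidean spaces\<close>

primrec C_k_on :: "nat \<Rightarrow> ('a::euclidean_space) set \<Rightarrow> ('a \<Rightarrow> 'b::real_normed_vector) \<Rightarrow> bool" where
  "C_k_on 0 S f \<longleftrightarrow> continuous_on S f"
| "C_k_on (Suc k) S f \<longleftrightarrow>
     (\<forall>x\<in>S. f differentiable (at x)) \<and>
     (\<forall>v. C_k_on k S (\<lambda>x. frechet_derivative f (at x) v))"

text \<open>Only used for open \<open>S\<close>.\<close>

definition smooth_on :: "('a::euclidean_space) set \<Rightarrow> ('a \<Rightarrow> 'b::real_normed_vector) \<Rightarrow> bool" where
  "smooth_on S f \<longleftrightarrow> (\<forall>k. C_k_on k S f)"


section \<open>Smooth manifolds\<close>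

text \<open>A chart is a pair \<open>(U, \<phi>)\<close>; only the values of \<open>\<phi>\<close> on \<open>U\<close> are meaningful.\<close>

type_synonym ('a, 'n) chart = "'a set \<times> ('a \<Rightarrow> real ^ 'n)"

definition chart_inv :: "('a, 'n) chart \<Rightarrow> real ^ 'n \<Rightarrow> 'a" where
  "chart_inv c = inv_into (fst c) (snd c)"

definition smooth_manifold :: "'a topology \<Rightarrow> ('a, 'n::finite) chart set \<Rightarrow> bool" where
  "smooth_manifold M A \<longleftrightarrow>
     Hausdorff_space M \<and> second_countable M \<and>
     (\<Union>c\<in>A. fst c) = topspace M \<and>
     (\<forall>c\<in>A. openin M (fst c) \<and> open (snd c ` fst c) \<and>
        homeomorphic_map (subtopology M (fst c)) (top_of_set (snd c ` fst c)) (snd c)) \<and>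
     (\<forall>c\<in>A. \<forall>c'\<in>A. smooth_on (snd c ` (fst c \<inter> fst c')) (snd c' \<circ> chart_inv c))"

definition smooth_fun :: "('a, 'n::finite) chart set \<Rightarrow> 'a set \<Rightarrow> ('a \<Rightarrow> real) \<Rightarrow> bool" where
  "smooth_fun A U f \<longleftrightarrow> (\<forall>c\<in>A. smooth_on (snd c ` (U \<inter> fst c)) (f \<circ> chart_inv c))"

definition chart_deriv ::
  "('a, 'n::finite) chart \<Rightarrow> ('a \<Rightarrow> 'b::real_normed_vector) \<Rightarrow> 'a \<Rightarrow> real ^ 'n \<Rightarrow> 'b" where
  "chart_deriv c f x = frechet_derivative (f \<circ> chart_inv c) (at (snd c x))"

text \<open>Differential at \<open>x\<close> of the change of coordinates from \<open>c\<close> to \<open>c'\<close>.\<close>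

definition transition_deriv ::
  "('a, 'n::finite) chart \<Rightarrow> ('a, 'n) chart \<Rightarrow> 'a \<Rightarrow> real ^ 'n \<Rightarrow> real ^ 'n" where
  "transition_deriv c c' x = chart_deriv c (snd c') x"


section \<open>Tensor fields\<close>

text \<open>
  A tensor field on an open set \<open>U\<close> is given by its components with respect to each chart \<open>c\<close>
  at each point of \<open>U \<inter> fst c\<close>, subject to the tensor transformation law; component values at
  other arguments are irrelevant, so equality of fields on \<open>U\<close> is \<open>vf_eq_on\<close>, not \<open>(=)\<close>.
\<close>

type_synonym ('a, 'n) vfield = "('a, 'n) chart \<Rightarrow> 'a \<Rightarrow> real ^ 'n"
type_synonym ('a, 'n) covfield = "('a, 'n) chart \<Rightarrow> 'a \<Rightarrow> real ^ 'n"
type_synonym ('a, 'n) bilinfield = "('a, 'n) chart \<Rightarrow> 'a \<Rightarrow> real ^ 'n ^ 'n"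

definition vector_field :: "('a, 'n::finite) chart set \<Rightarrow> 'a set \<Rightarrow> ('a, 'n) vfield \<Rightarrow> bool" where
  "vector_field A U X \<longleftrightarrow>
     (\<forall>c\<in>A. smooth_on (snd c ` (U \<inter> fst c)) (X c \<circ> chart_inv c)) \<and>
     (\<forall>c\<in>A. \<forall>c'\<in>A. \<forall>x \<in> U \<inter> fst c \<inter> fst c'. X c' x = transition_deriv c c' x (X c x))"

definition one_form :: "('a, 'n::finite) chart set \<Rightarrow> 'a set \<Rightarrow> ('a, 'n) covfield \<Rightarrow> bool" where
  "one_form A U \<Upsilon> \<longleftrightarrow>
     (\<forall>c\<in>A. smooth_on (snd c ` (U \<inter> fst c)) (\<Upsilon> c \<circ> chart_inv c)) \<and>
     (\<forall>c\<in>A. \<forall>c'\<in>A. \<forall>x \<in> U \<inter> fst c \<inter> fst c'. \<forall>v.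
        \<Upsilon> c' x \<bullet> transition_deriv c c' x v = \<Upsilon> c x \<bullet> v)"

definition vf_eq_on ::
  "('a, 'n::finite) chart set \<Rightarrow> 'a set \<Rightarrow> ('a, 'n) vfield \<Rightarrow> ('a, 'n) vfield \<Rightarrow> bool" where
  "vf_eq_on A U X Y \<longleftrightarrow> (\<forall>c\<in>A. \<forall>x \<in> U \<inter> fst c. X c x = Y c x)"

definition lie_bracket :: "('a, 'n::finite) vfield \<Rightarrow> ('a, 'n) vfield \<Rightarrow> ('a, 'n) vfield" where
  "lie_bracket X Y = (\<lambda>c x. chart_deriv c (Y c) x (X c x) - chart_deriv c (X c) x (Y c x))"

text \<open>The coordinate vector field \<open>\<partial>\<^sub>a\<close> of the chart \<open>c\<close>, a vector field on \<open>fst c\<close>.\<close>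

definition coord_field :: "('a, 'n::finite) chart \<Rightarrow> 'n \<Rightarrow> ('a, 'n) vfield" where
  "coord_field c a = (\<lambda>c' x. transition_deriv c c' x (axis a 1))"

definition pseudo_riemannian_metric ::
  "'a topology \<Rightarrow> ('a, 'n::finite) chart set \<Rightarrow> ('a, 'n) bilinfield \<Rightarrow> bool" where
  "pseudo_riemannian_metric M A g \<longleftrightarrow>
     (\<forall>c\<in>A. smooth_on (snd c ` fst c) (g c \<circ> chart_inv c)) \<and>
     (\<forall>c\<in>A. \<forall>x \<in> fst c. transpose (g c x) = g c x \<and> invertible (g c x)) \<and>
     (\<forall>c\<in>A. \<forall>c'\<in>A. \<forall>x \<in> fst c \<inter> fst c'. \<forall>v w.
        transition_deriv c c' x v \<bullet> (g c' x *v transition_deriv c c' x w) = v \<bullet> (g c x *v w))"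


section \<open>Affine connections\<close>

text \<open>
  A connection is taken as acting on vector fields over arbitrary open sets, compatibly with
  restriction: \<open>nabla U X Y\<close> is the field \<open>X\<^sup>a \<nabla>\<^sub>a Y\<^sup>b\<close> on \<open>U\<close>. Since a
  connection on global vector fields is a local operator, it extends uniquely to this form.
\<close>

type_synonym ('a, 'n) conn =
  "'a set \<Rightarrow> ('a, 'n) vfield \<Rightarrow> ('a, 'n) vfield \<Rightarrow> ('a, 'n) vfield"

definition affine_connection ::
  "'a topology \<Rightarrow> ('a, 'n::finite) chart set \<Rightarrow> ('a, 'n) conn \<Rightarrow> bool" where
  "affine_connection M A nabla \<longleftrightarrow>
     (\<forall>U X Y. openin M U \<and> vector_field A U X \<and> vector_field A U Y \<longrightarrow>
        vector_field A U (nabla U X Y)) \<and>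
     (\<forall>U V W X X' Y Y'. openin M U \<and> openin M V \<and> openin M W \<and> W \<subseteq> U \<inter> V \<and>
        vector_field A U X \<and> vector_field A U Y \<and> vector_field A V X' \<and> vector_field A V Y' \<and>
        vf_eq_on A W X X' \<and> vf_eq_on A W Y Y' \<longrightarrow>
        vf_eq_on A W (nabla U X Y) (nabla V X' Y')) \<and>
     (\<forall>U X X' Y. openin M U \<and> vector_field A U X \<and> vector_field A U X' \<and> vector_field A U Y \<longrightarrow>
        vf_eq_on A U (nabla U (\<lambda>c x. X c x + X' c x) Y)
          (\<lambda>c x. nabla U X Y c x + nabla U X' Y c x)) \<and>
     (\<forall>U f X Y. openin M U \<and> smooth_fun A U f \<and> vector_field A U X \<and> vector_field A U Y \<longrightarrow>
        vf_eq_on A U (nabla U (\<lambda>c x. f x *\<^sub>R X c x) Y) (\<lambda>c x. f x *\<^sub>R nabla U X Y c x)) \<and>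
     (\<forall>U X Y Y'. openin M U \<and> vector_field A U X \<and> vector_field A U Y \<and> vector_field A U Y' \<longrightarrow>
        vf_eq_on A U (nabla U X (\<lambda>c x. Y c x + Y' c x))
          (\<lambda>c x. nabla U X Y c x + nabla U X Y' c x)) \<and>
     (\<forall>U f X Y. openin M U \<and> smooth_fun A U f \<and> vector_field A U X \<and> vector_field A U Y \<longrightarrow>
        vf_eq_on A U (nabla U X (\<lambda>c x. f x *\<^sub>R Y c x))
          (\<lambda>c x. f x *\<^sub>R nabla U X Y c x + chart_deriv c f x (X c x) *\<^sub>R Y c x))"

definition torsion_free ::
  "'a topology \<Rightarrow> ('a, 'n::finite) chart set \<Rightarrow> ('a, 'n) conn \<Rightarrow> bool" where
  "torsion_free M A nabla \<longleftrightarrow>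
     (\<forall>U X Y. openin M U \<and> vector_field A U X \<and> vector_field A U Y \<longrightarrow>
        vf_eq_on A U (\<lambda>c x. nabla U X Y c x - nabla U Y X c x) (lie_bracket X Y))"

definition levi_civita_connection ::
  "'a topology \<Rightarrow> ('a, 'n::finite) chart set \<Rightarrow> ('a, 'n) bilinfield \<Rightarrow> ('a, 'n) conn \<Rightarrow> bool" where
  "levi_civita_connection M A g nabla \<longleftrightarrow>
     affine_connection M A nabla \<and> torsion_free M A nabla \<and>
     (\<forall>U X Y Z. openin M U \<and> vector_field A U X \<and> vector_field A U Y \<and> vector_field A U Z \<longrightarrow>
        (\<forall>c\<in>A. \<forall>x \<in> U \<inter> fst c.
           chart_deriv c (\<lambda>y. Y c y \<bullet> (g c y *v Z c y)) x (X c x) =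
             nabla U X Y c x \<bullet> (g c x *v Z c x) + Y c x \<bullet> (g c x *v nabla U X Z c x)))"


section \<open>Projective structures\<close>

definition torsion_free_connections ::
  "'a topology \<Rightarrow> ('a, 'n::finite) chart set \<Rightarrow> ('a, 'n) conn set" where
  "torsion_free_connections M A = {nabla. affine_connection M A nabla \<and> torsion_free M A nabla}"

text \<open>\<open>\<nabla>'\<^sub>X Y = \<nabla>\<^sub>X Y + \<Upsilon>(X) Y + \<Upsilon>(Y) X\<close>\<close>

definition projective_rel ::
  "'a topology \<Rightarrow> ('a, 'n::finite) chart set \<Rightarrow> (('a, 'n) conn \<times> ('a, 'n) conn) set" where
  "projective_rel M A =
     {(nabla, nabla'). nabla \<in> torsion_free_connections M A \<and>
        nabla' \<in> torsion_free_connections M A \<and>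
        (\<exists>\<Upsilon>. one_form A (topspace M) \<Upsilon> \<and>
          (\<forall>U X Y. openin M U \<and> vector_field A U X \<and> vector_field A U Y \<longrightarrow>
             vf_eq_on A U (nabla' U X Y)
               (\<lambda>c x. nabla U X Y c x + (\<Upsilon> c x \<bullet> X c x) *\<^sub>R Y c x + (\<Upsilon> c x \<bullet> Y c x) *\<^sub>R X c x)))}"

definition projective_structure ::
  "'a topology \<Rightarrow> ('a, 'n::finite) chart set \<Rightarrow> ('a, 'n) conn set \<Rightarrow> bool" where
  "projective_structure M A p \<longleftrightarrow> p \<in> torsion_free_connections M A // projective_rel M A"


section \<open>Curvature and the projective Weyl tensor\<close>

text \<open>\<open>X\<^sup>a Y\<^sup>b \<nabla>\<^sub>a \<nabla>\<^sub>b Z\<^sup>c\<close>\<close>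

definition second_cov_deriv ::
  "('a, 'n::finite) conn \<Rightarrow> 'a set \<Rightarrow> ('a, 'n) vfield \<Rightarrow> ('a, 'n) vfield \<Rightarrow> ('a, 'n) vfield
     \<Rightarrow> ('a, 'n) vfield" where
  "second_cov_deriv nabla U X Y Z =
     (\<lambda>c x. nabla U X (nabla U Y Z) c x - nabla U (nabla U X Y) Z c x)"

text \<open>
  \<open>curvature nabla c x a b i d\<close> is \<open>R\<^sub>a\<^sub>b\<^sup>i\<^sub>d\<close> at \<open>x\<close>, in the coordinate frame of \<open>c\<close>; the
  same order of indices is used for the Weyl tensor. For torsion-free connections this is a tensor.
\<close>

definition curvature ::
  "('a, 'n::finite) conn \<Rightarrow> ('a, 'n) chart \<Rightarrow> 'a \<Rightarrow> 'n \<Rightarrow> 'n \<Rightarrow> 'n \<Rightarrow> 'n \<Rightarrow> real" where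
  "curvature nabla c x a b i d =
     (second_cov_deriv nabla (fst c) (coord_field c a) (coord_field c b) (coord_field c d) c x
      - second_cov_deriv nabla (fst c) (coord_field c b) (coord_field c a) (coord_field c d) c x) $ i"

definition kronecker :: "'n \<Rightarrow> 'n \<Rightarrow> real" where
  "kronecker i j = (if i = j then 1 else 0)"

definition completely_trace_free :: "('n::finite \<Rightarrow> 'n \<Rightarrow> 'n \<Rightarrow> 'n \<Rightarrow> real) \<Rightarrow> bool" where
  "completely_trace_free W \<longleftrightarrow>
     (\<forall>b d. (\<Sum>i\<in>UNIV. W i b i d) = 0) \<and>
     (\<forall>a d. (\<Sum>i\<in>UNIV. W a i i d) = 0) \<and>
     (\<forall>a b. (\<Sum>i\<in>UNIV. W a b i i) = 0)"

definition weyl_decomposition ::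
  "('n::finite \<Rightarrow> 'n \<Rightarrow> 'n \<Rightarrow> 'n \<Rightarrow> real) \<Rightarrow> ('n \<Rightarrow> 'n \<Rightarrow> 'n \<Rightarrow> 'n \<Rightarrow> real) \<Rightarrow>
     ('n \<Rightarrow> 'n \<Rightarrow> real) \<Rightarrow> ('n \<Rightarrow> 'n \<Rightarrow> real) \<Rightarrow> bool" where
  "weyl_decomposition R W P \<beta> \<longleftrightarrow>
     completely_trace_free W \<and>
     (\<forall>a b. \<beta> a b = - (P a b - P b a)) \<and>
     (\<forall>a b i d. R a b i d =
        W a b i d + (kronecker i a * P b d - kronecker i b * P a d) + \<beta> a b * kronecker i d)"

text \<open>The projective Weyl tensor is the same for all connections in \<open>p\<close>.\<close>

definition weyl_tensor ::
  "('a, 'n::finite) conn set \<Rightarrow> ('a, 'n) chart \<Rightarrow> 'a \<Rightarrow> 'n \<Rightarrow> 'n \<Rightarrow> 'n \<Rightarrow> 'n \<Rightarrow> real" where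
  "weyl_tensor p c x =
     (THE W. \<forall>nabla\<in>p. \<exists>P \<beta>. weyl_decomposition (curvature nabla c x) W P \<beta>)"

text \<open>
  \<open>p_form p k c x a\<close> is the component of \<open>p\<^sub>k\<close> with indices \<open>a 0, \<dots>, a (2 * k - 1)\<close>. The
  contracted indices are \<open>i 0, \<dots>, i (k - 1)\<close>, cyclically.
\<close>

definition p_form ::
  "('a, 'n::finite) conn set \<Rightarrow> nat \<Rightarrow> ('a, 'n) chart \<Rightarrow> 'a \<Rightarrow> (nat \<Rightarrow> 'n) \<Rightarrow> real" where
  "p_form p k c x a =
     (\<Sum>\<sigma> | \<sigma> permutes {..<2 * k}. of_int (sign \<sigma>) *
        (\<Sum>i \<in> {..<k} \<rightarrow>\<^sub>E UNIV.
           \<Prod>j<k. weyl_tensor p c x (a (\<sigma> (2 * j))) (a (\<sigma> (2 * j + 1))) (i j) (i (Suc j mod k))))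
     / fact (2 * k)"

end

(*
  Let nabla be a Levi-Civita connection in p, with curvature R. Each R_ab is skew-adjoint for the
  metric, so tr (R_1 ... R_k) = (-1)^k tr (R_k ... R_1); reversing the order of k pairs of indices is
  an even permutation, so the alternation of the trace vanishes for odd k. Since the Ricci tensor is
  symmetric, R = W + S with S_ab^i_d = delta^i_a P_bd - delta^i_b P_ad and P symmetric. In the
  alternated trace the factors R may be replaced by W one at a time: contracting S with the factor
  preceding it produces a term that vanishes by the algebraic Bianchi identity for that factor.
*)
theory Submission
  imports Defs
begin

section \<open>Calculus of smooth maps\<close>

text \<open>The detour through R is forced: reversing the trace needs endomorphisms that are
  skew-adjoint for the metric, and the projective Weyl tensor of a Levi-Civita connection is in
  general not skew-adjoint. On the other hand \<open>p_form\<close> is built from the Weyl tensor, a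
  definite description over all connections in \<open>p\<close>; it can be compared with the
  curvature of one connection only once a projective change is known to affect just P and \<beta>,
  and the decomposition is known to be unique. Symmetry of the Ricci tensor is again
  skew-adjointness: the trace of R_ab vanishes, and this trace is (n + 1) \<beta>_ab.
  Skew-adjointness itself comes from differentiating the metric coefficients twice, which is why
  symmetry of second derivatives is established for the recursive notion \<open>C_k_on\<close>.
  Replacing R by W uses a factor preceding S and distinct from it, hence k \<ge> 2; for k = 1 the
  form is a trace of W and vanishes at once.\<close>

lemma C_k_on_cong:
  assumes "open S" "\<And>x. x \<in> S \<Longrightarrow> f x = g x" "C_k_on k S f"
  shows "C_k_on k S g"
  using assms(2,3)
proof (induction k arbitrary: f g)
  case 0
  then show ?case using continuous_on_cong by fastforce
next
  case (Suc k)
  have "g differentiable at x" if "x \<in> S" for x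
    using Suc.prems that
    by (metis C_k_on.simps(2) assms(1) differentiable_def has_derivative_transform_within_open)
  moreover have "C_k_on k S (\<lambda>x. frechet_derivative g (at x) v)" for v
  proof (rule Suc.IH)
    show "C_k_on k S (\<lambda>x. frechet_derivative f (at x) v)" using Suc.prems by simp
    show "frechet_derivative f (at x) v = frechet_derivative g (at x) v" if "x \<in> S" for x
      using Suc.prems that frechet_derivative_transform_within_open[of f x S g] \<open>open S\<close> by simp
  qed
  ultimately show ?case by simp
qed

lemma C_k_on_mono: "C_k_on (Suc k) S f \<Longrightarrow> C_k_on k S f"
proof (induction k arbitrary: f)
  case 0
  then show ?case
    by (auto intro!: continuous_at_imp_continuous_on differentiable_imp_continuous_within)
next
  case (Suc k)
  then show ?case by (metis C_k_on.simps(2))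
qed

lemma C_k_on_subset: "C_k_on k S f \<Longrightarrow> T \<subseteq> S \<Longrightarrow> C_k_on k T f"
  by (induction k arbitrary: f) (auto intro: continuous_on_subset)

lemma frechet_derivative_eqI:
  "(f has_derivative f') (at x) \<Longrightarrow> frechet_derivative f (at x) = f'"
  using frechet_derivative_at by metis

lemma C_k_on_has_derivative:
  "C_k_on (Suc k) S f \<Longrightarrow> x \<in> S \<Longrightarrow> (f has_derivative frechet_derivative f (at x)) (at x)"
  by (simp flip: frechet_derivative_works)

lemma C_k_on_const: "C_k_on k S (\<lambda>x. c)"
  by (induction k arbitrary: c) auto

lemma C_k_on_add:
  assumes "open S"
  shows "C_k_on k S f \<Longrightarrow> C_k_on k S g \<Longrightarrow> C_k_on k S (\<lambda>x. f x + g x)"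
proof (induction k arbitrary: f g)
  case 0
  then show ?case by (simp add: continuous_on_add)
next
  case (Suc k)
  show ?case unfolding C_k_on.simps
  proof (intro conjI allI ballI)
    show "(\<lambda>x. f x + g x) differentiable at x" if "x \<in> S" for x
      using that Suc.prems by simp
    show "C_k_on k S (\<lambda>x. frechet_derivative (\<lambda>x. f x + g x) (at x) v)" for v
    \<comment> \<open>The sum rule for \<open>frechet_derivative\<close> holds at points of
      \<open>S\<close> only, so the formula replaces the derivative by congruence on the open set
      \<open>S\<close>. The same pattern serves products, linear images and compositions.\<close>
    proof (rule C_k_on_cong[OF assms])
      show "C_k_on k S (\<lambda>x. frechet_derivative f (at x) v + frechet_derivative g (at x) v)"
        using Suc.prems by (intro Suc.IH) auto
      show "frechet_derivative f (at x) v + frechet_derivative g (at x) v =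
          frechet_derivative (\<lambda>x. f x + g x) (at x) v" if "x \<in> S" for x
        by (rule frechet_derivative_eqI[OF has_derivative_add, symmetric, THEN fun_cong])
          (use that Suc.prems in \<open>auto intro!: C_k_on_has_derivative simp del: C_k_on.simps\<close>)
    qed
  qed
qed

lemma C_k_on_scaleR:
  assumes "open S"
  shows "C_k_on k S f \<Longrightarrow> C_k_on k S g \<Longrightarrow> C_k_on k S (\<lambda>x. f x *\<^sub>R g x)"
proof (induction k arbitrary: f g)
  case 0
  then show ?case by (simp add: continuous_on_scaleR)
next
  case (Suc k)
  show ?case unfolding C_k_on.simps
  proof (intro conjI allI ballI)
    show "(\<lambda>x. f x *\<^sub>R g x) differentiable at x" if "x \<in> S" for x
      using that Suc.prems by simp
    show "C_k_on k S (\<lambda>x. frechet_derivative (\<lambda>x. f x *\<^sub>R g x) (at x) v)" for v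
    proof (rule C_k_on_cong[OF assms])
      show "C_k_on k S (\<lambda>x. f x *\<^sub>R frechet_derivative g (at x) v + frechet_derivative f (at x) v *\<^sub>R g x)"
        \<comment> \<open>The product rule pairs derivatives, which are of order \<open>k\<close>,
          with the undifferentiated \<open>f\<close> and \<open>g\<close>, whose order has to be
          lowered to match.\<close>
        using Suc.prems C_k_on_mono[OF Suc.prems(1)] C_k_on_mono[OF Suc.prems(2)]
        by (intro C_k_on_add[OF assms] Suc.IH) auto
      show "f x *\<^sub>R frechet_derivative g (at x) v + frechet_derivative f (at x) v *\<^sub>R g x =
          frechet_derivative (\<lambda>x. f x *\<^sub>R g x) (at x) v" if "x \<in> S" for x
        by (rule frechet_derivative_eqI[OF has_derivative_scaleR, symmetric, THEN fun_cong])
          (use that Suc.prems in \<open>auto intro!: C_k_on_has_derivative simp del: C_k_on.simps\<close>)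
    qed
  qed
qed

lemma C_k_on_sum:
  assumes "open S" "\<And>i. i \<in> I \<Longrightarrow> C_k_on k S (f i)"
  shows "C_k_on k S (\<lambda>x. \<Sum>i\<in>I. f i x)"
  using assms(2)
  by (induction I rule: infinite_finite_induct) (auto intro: C_k_on_const C_k_on_add[OF assms(1)])

lemma C_k_on_bounded_linear:
  assumes "open S" "bounded_linear L"
  shows "C_k_on k S f \<Longrightarrow> C_k_on k S (\<lambda>x. L (f x))"
proof (induction k arbitrary: f)
  case 0
  then show ?case using bounded_linear.continuous_on[OF assms(2)] by simp
next
  case (Suc k)
  have D: "((\<lambda>x. L (f x)) has_derivative (\<lambda>v. L (frechet_derivative f (at x) v))) (at x)"
    if "x \<in> S" for x
    by (rule bounded_linear.has_derivative[OF assms(2) C_k_on_has_derivative[OF Suc.prems that]])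
  have "C_k_on k S (\<lambda>x. frechet_derivative (\<lambda>x. L (f x)) (at x) v)" for v
  proof (rule C_k_on_cong[OF assms(1)])
    show "C_k_on k S (\<lambda>x. L (frechet_derivative f (at x) v))"
      using Suc.prems by (intro Suc.IH) simp
  qed (simp add: frechet_derivative_eqI[OF D])
  then show ?case using D by (auto simp: differentiable_def)
qed

lemma C_k_on_compose:
  fixes f :: "'a::euclidean_space \<Rightarrow> 'b::euclidean_space" and g :: "'b \<Rightarrow> 'c::real_normed_vector"
  assumes "open S" "open T" "f ` S \<subseteq> T"
  shows "C_k_on k S f \<Longrightarrow> C_k_on k T g \<Longrightarrow> C_k_on k S (\<lambda>x. g (f x))"
proof (induction k arbitrary: g)
  case 0
  then show ?case using continuous_on_compose2[OF _ _ assms(3)] by simp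
next
  case (Suc k)
  \<comment> \<open>The chain rule differentiates \<open>g\<close> in a direction that varies with
    x, whereas \<open>C_k_on\<close> speaks of fixed directions. Expanding over the basis leaves
    derivatives of \<open>g\<close> in fixed directions b, composed with \<open>f\<close>, to which
    the induction hypothesis applies.\<close>
  let ?D = "\<lambda>x v. \<Sum>b\<in>Basis. (frechet_derivative f (at x) v \<bullet> b) *\<^sub>R frechet_derivative g (at (f x)) b"
  have D: "((\<lambda>x. g (f x)) has_derivative (\<lambda>v. frechet_derivative g (at (f x)) (frechet_derivative f (at x) v))) (at x)"
    and lin: "linear (frechet_derivative g (at (f x)))"
    if "x \<in> S" for x
  proof -
    have fx: "f x \<in> T" using that assms(3) by blast
    show "((\<lambda>x. g (f x)) has_derivative (\<lambda>v. frechet_derivative g (at (f x)) (frechet_derivative f (at x) v))) (at x)"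
      by (rule has_derivative_compose[OF C_k_on_has_derivative[OF Suc.prems(1) that]
            C_k_on_has_derivative[OF Suc.prems(2) fx]])
    show "linear (frechet_derivative g (at (f x)))"
      by (rule has_derivative_linear[OF C_k_on_has_derivative[OF Suc.prems(2) fx]])
  qed
  have "C_k_on k S (\<lambda>x. frechet_derivative (\<lambda>x. g (f x)) (at x) v)" for v
  proof (rule C_k_on_cong[OF assms(1)])
    show "C_k_on k S (\<lambda>x. ?D x v)"
    proof (intro C_k_on_sum[OF assms(1)] C_k_on_scaleR[OF assms(1)] Suc.IH)
      show "C_k_on k S (\<lambda>x. frechet_derivative f (at x) v \<bullet> b)" for b
        using Suc.prems by (intro C_k_on_bounded_linear[OF assms(1) bounded_linear_inner_left]) simp
    qed (use Suc.prems C_k_on_mono[OF Suc.prems(1)] in auto)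
    show "?D x v = frechet_derivative (\<lambda>x. g (f x)) (at x) v" if "x \<in> S" for x
      unfolding frechet_derivative_eqI[OF D[OF that]]
      using linear_sum[OF lin[OF that], of "\<lambda>b. (frechet_derivative f (at x) v \<bullet> b) *\<^sub>R b" Basis]
      by (simp add: linear_cmul[OF lin[OF that]] euclidean_representation)
  qed
  then show ?case using D by (auto simp: differentiable_def)
qed

lemma smooth_on_cong:
  "open S \<Longrightarrow> smooth_on S f \<Longrightarrow> (\<And>x. x \<in> S \<Longrightarrow> f x = g x) \<Longrightarrow> smooth_on S g"
  unfolding smooth_on_def using C_k_on_cong by blast

lemma smooth_on_subset: "smooth_on S f \<Longrightarrow> T \<subseteq> S \<Longrightarrow> smooth_on T f"
  unfolding smooth_on_def using C_k_on_subset by blast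

lemma smooth_on_add:
  "open S \<Longrightarrow> smooth_on S f \<Longrightarrow> smooth_on S g \<Longrightarrow> smooth_on S (\<lambda>x. f x + g x)"
  unfolding smooth_on_def using C_k_on_add by blast

lemma smooth_on_scaleR:
  "open S \<Longrightarrow> smooth_on S f \<Longrightarrow> smooth_on S g \<Longrightarrow> smooth_on S (\<lambda>x. f x *\<^sub>R g x)"
  unfolding smooth_on_def using C_k_on_scaleR by blast

lemma smooth_on_bounded_linear:
  "open S \<Longrightarrow> bounded_linear L \<Longrightarrow> smooth_on S f \<Longrightarrow> smooth_on S (\<lambda>x. L (f x))"
  unfolding smooth_on_def using C_k_on_bounded_linear by blast

lemma smooth_on_compose:
  fixes f :: "'a::euclidean_space \<Rightarrow> 'b::euclidean_space" and g :: "'b \<Rightarrow> 'c::real_normed_vector"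
  shows "open S \<Longrightarrow> open T \<Longrightarrow> f ` S \<subseteq> T \<Longrightarrow> smooth_on S f \<Longrightarrow> smooth_on T g \<Longrightarrow>
    smooth_on S (\<lambda>x. g (f x))"
  unfolding smooth_on_def using C_k_on_compose by blast

lemma smooth_on_frechet_derivative:
  "smooth_on S f \<Longrightarrow> smooth_on S (\<lambda>x. frechet_derivative f (at x) v)"
  unfolding smooth_on_def using C_k_on.simps(2) by blast

lemma smooth_on_has_derivative:
  "smooth_on S f \<Longrightarrow> x \<in> S \<Longrightarrow> (f has_derivative frechet_derivative f (at x)) (at x)"
  unfolding smooth_on_def using C_k_on.simps(2) frechet_derivative_works by blast

section \<open>Symmetry of second derivatives\<close>

lemma has_real_derivative_along_line:
  fixes f :: "'a::real_normed_vector \<Rightarrow> real"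
  assumes "f differentiable at (c + s *\<^sub>R v)"
  shows "((\<lambda>s. f (c + s *\<^sub>R v)) has_real_derivative frechet_derivative f (at (c + s *\<^sub>R v)) v) (at s)"
proof -
  have "((\<lambda>s. f (c + s *\<^sub>R v)) has_derivative (\<lambda>h. frechet_derivative f (at (c + s *\<^sub>R v)) (h *\<^sub>R v))) (at s)"
    by (rule has_derivative_compose[of "\<lambda>s. c + s *\<^sub>R v" _ _ UNIV f])
      (auto intro!: derivative_eq_intros frechet_derivative_works[THEN iffD1] assms)
  also have "(\<lambda>h. frechet_derivative f (at (c + s *\<^sub>R v)) (h *\<^sub>R v)) = (*) (frechet_derivative f (at (c + s *\<^sub>R v)) v)"
    using linear_cmul[OF linear_frechet_derivative[OF assms]] by (simp add: fun_eq_iff)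
  finally show ?thesis by (simp add: has_field_derivative_def)
qed

text \<open>The mean value theorem is used twice: for the difference of \<open>f\<close> along two
  parallel segments in direction \<open>v\<close>, then for the v-derivative of \<open>f\<close>
  along \<open>w\<close>. The point of the equation is that its left side is symmetric in
  \<open>v\<close> and \<open>w\<close>.\<close>

lemma second_difference_mean_value:
  fixes f :: "'a::real_normed_vector \<Rightarrow> real"
  assumes "h > 0"
    and S: "\<And>s t. 0 \<le> s \<Longrightarrow> s \<le> h \<Longrightarrow> 0 \<le> t \<Longrightarrow> t \<le> h \<Longrightarrow> x + s *\<^sub>R v + t *\<^sub>R w \<in> S"
    and f: "\<And>y. y \<in> S \<Longrightarrow> f differentiable at y"
    and Df: "\<And>y. y \<in> S \<Longrightarrow> (\<lambda>y. frechet_derivative f (at y) v) differentiable at y"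
  obtains s t where "0 < s" "s < h" "0 < t" "t < h"
    "f (x + h *\<^sub>R v + h *\<^sub>R w) - f (x + h *\<^sub>R v) - f (x + h *\<^sub>R w) + f x =
      h * h * frechet_derivative (\<lambda>y. frechet_derivative f (at y) v) (at (x + s *\<^sub>R v + t *\<^sub>R w)) w"
proof -
  let ?D = "\<lambda>y. frechet_derivative f (at y) v"
  have "((\<lambda>s. f (x + h *\<^sub>R w + s *\<^sub>R v) - f (x + s *\<^sub>R v)) has_real_derivative
      ?D (x + h *\<^sub>R w + s *\<^sub>R v) - ?D (x + s *\<^sub>R v)) (at s)" if "0 \<le> s" "s \<le> h" for s
  proof (intro DERIV_diff has_real_derivative_along_line f)
    show "x + h *\<^sub>R w + s *\<^sub>R v \<in> S" using S[of s h] that \<open>h > 0\<close> by (simp add: algebra_simps)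
    show "x + s *\<^sub>R v \<in> S" using S[of s 0] that \<open>h > 0\<close> by simp
  qed
  from MVT2[OF \<open>h > 0\<close> this] obtain s where s: "0 < s" "s < h"
    and 1: "f (x + h *\<^sub>R w + h *\<^sub>R v) - f (x + h *\<^sub>R v) - (f (x + h *\<^sub>R w) - f x) =
      h * (?D (x + h *\<^sub>R w + s *\<^sub>R v) - ?D (x + s *\<^sub>R v))"
    by auto
  have "((\<lambda>t. ?D (x + s *\<^sub>R v + t *\<^sub>R w)) has_real_derivative
      frechet_derivative ?D (at (x + s *\<^sub>R v + t *\<^sub>R w)) w) (at t)" if "0 \<le> t" "t \<le> h" for t
    using s that by (intro has_real_derivative_along_line Df S) auto
  from MVT2[OF \<open>h > 0\<close> this] obtain t where t: "0 < t" "t < h"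
    and 2: "?D (x + s *\<^sub>R v + h *\<^sub>R w) - ?D (x + s *\<^sub>R v) =
      h * frechet_derivative ?D (at (x + s *\<^sub>R v + t *\<^sub>R w)) w"
    by auto
  have "x + h *\<^sub>R w + s *\<^sub>R v = x + s *\<^sub>R v + h *\<^sub>R w" "x + h *\<^sub>R w + h *\<^sub>R v = x + h *\<^sub>R v + h *\<^sub>R w"
    by simp_all
  with 1 2 have "f (x + h *\<^sub>R v + h *\<^sub>R w) - f (x + h *\<^sub>R v) - f (x + h *\<^sub>R w) + f x =
      h * h * frechet_derivative ?D (at (x + s *\<^sub>R v + t *\<^sub>R w)) w"
    by simp
  with s t that show thesis by blast
qed

text \<open>The same second difference equals h * h times either mixed derivative, each at some
  point near \<open>x\<close>. If the two orders differed at \<open>x\<close>, continuity would keep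
  them apart nearby.\<close>

lemma second_derivative_symmetric:
  fixes f :: "'a::euclidean_space \<Rightarrow> real"
  assumes "open S" "C_k_on 2 S f" "x \<in> S"
  shows "frechet_derivative (\<lambda>y. frechet_derivative f (at y) v) (at x) w =
    frechet_derivative (\<lambda>y. frechet_derivative f (at y) w) (at x) v"
proof (rule ccontr)
  define p where "p v w y = frechet_derivative (\<lambda>y. frechet_derivative f (at y) v) (at y) w" for v w y
  assume "\<not> ?thesis"
  then have ne: "p v w x \<noteq> p w v x" by (simp add: p_def)
  have f: "f differentiable at y" "(\<lambda>y. frechet_derivative f (at y) u) differentiable at y"
    if "y \<in> S" for y u
    using assms(2) that by (auto simp: numeral_2_eq_2)
  have cont: "isCont (p u u') x" for u u'
    unfolding p_def[abs_def] using assms by (auto simp: numeral_2_eq_2 continuous_on_eq_continuous_at)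
  \<comment> \<open>Half the gap: two numbers that lie within \<open>e\<close> of the two different
    values at \<open>x\<close> cannot coincide.\<close>
  define e where "e = \<bar>p v w x - p w v x\<bar> / 2"
  have "e > 0" using ne by (simp add: e_def)
  have "\<forall>\<^sub>F y in nhds x. \<bar>p u u' y - p u u' x\<bar> < e" for u u'
  proof -
    have "(p u u' \<longlongrightarrow> p u u' x) (nhds x)"
      using cont[of u u'] by (simp add: isCont_def tendsto_at_iff_tendsto_nhds)
    from tendstoD[OF this \<open>e > 0\<close>] show ?thesis by (simp add: dist_real_def)
  qed
  note this[of v w] this[of w v]
  then have "\<forall>\<^sub>F y in nhds x. y \<in> S \<and> \<bar>p v w y - p v w x\<bar> < e \<and> \<bar>p w v y - p w v x\<bar> < e"
    using eventually_nhds_in_open[OF assms(1,3)] by (intro eventually_conj) auto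
  then obtain d where "d > 0"
    and d: "\<And>y. dist y x < d \<Longrightarrow> y \<in> S \<and> \<bar>p v w y - p v w x\<bar> < e \<and> \<bar>p w v y - p w v x\<bar> < e"
    unfolding eventually_nhds_metric by auto
  \<comment> \<open>The summand 1 keeps \<open>m\<close> positive when \<open>v\<close> and
    \<open>w\<close> vanish; the 2 in \<open>h\<close> puts the whole parallelogram spanned by h v
    and h w inside the ball of radius \<open>d\<close>.\<close>
  define m where "m = norm v + norm w + 1"
  define h where "h = d / (2 * m)"
  have pos: "m > 0" unfolding m_def by (smt (verit) norm_ge_zero)
  have "h > 0" using \<open>d > 0\<close> pos by (simp add: h_def)
  have hd: "h * (norm v + norm w) < d"
  proof -
    have "h * (norm v + norm w) \<le> h * m" using \<open>h > 0\<close> by (simp add: m_def)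
    also have "\<dots> = d / 2" using pos by (simp add: h_def)
    finally show ?thesis using \<open>d > 0\<close> by simp
  qed
  have near: "dist (x + s *\<^sub>R v + t *\<^sub>R w) x < d" if "0 \<le> s" "s \<le> h" "0 \<le> t" "t \<le> h" for s t
  proof -
    have "norm (s *\<^sub>R v + t *\<^sub>R w) \<le> s * norm v + t * norm w"
      using that norm_triangle_ineq[of "s *\<^sub>R v" "t *\<^sub>R w"] by simp
    also have "\<dots> \<le> h * (norm v + norm w)"
      using that by (simp add: distrib_left add_mono mult_right_mono)
    finally show ?thesis using hd by (simp add: dist_norm add.assoc)
  qed
  have near': "dist (x + s *\<^sub>R w + t *\<^sub>R v) x < d" if "0 \<le> s" "s \<le> h" "0 \<le> t" "t \<le> h" for s t
    using near[of t s] that by (simp add: algebra_simps)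
  obtain s t where st: "0 < s" "s < h" "0 < t" "t < h" and
    1: "f (x + h *\<^sub>R v + h *\<^sub>R w) - f (x + h *\<^sub>R v) - f (x + h *\<^sub>R w) + f x = h * h * p v w (x + s *\<^sub>R v + t *\<^sub>R w)"
    unfolding p_def
    by (rule second_difference_mean_value[OF \<open>h > 0\<close>, of x v w S f]) (use near d f in auto)
  obtain s' t' where st': "0 < s'" "s' < h" "0 < t'" "t' < h" and
    2: "f (x + h *\<^sub>R w + h *\<^sub>R v) - f (x + h *\<^sub>R w) - f (x + h *\<^sub>R v) + f x = h * h * p w v (x + s' *\<^sub>R w + t' *\<^sub>R v)"
    unfolding p_def
    by (rule second_difference_mean_value[OF \<open>h > 0\<close>, of x w v S f]) (use near' d f in auto)
  have "x + h *\<^sub>R w + h *\<^sub>R v = x + h *\<^sub>R v + h *\<^sub>R w" by simp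
  with 2 have "f (x + h *\<^sub>R v + h *\<^sub>R w) - f (x + h *\<^sub>R w) - f (x + h *\<^sub>R v) + f x =
      h * h * p w v (x + s' *\<^sub>R w + t' *\<^sub>R v)"
    by (simp only:)
  with 1 have "h * h * p v w (x + s *\<^sub>R v + t *\<^sub>R w) = h * h * p w v (x + s' *\<^sub>R w + t' *\<^sub>R v)"
    by linarith
  then have "p v w (x + s *\<^sub>R v + t *\<^sub>R w) = p w v (x + s' *\<^sub>R w + t' *\<^sub>R v)"
    using \<open>h > 0\<close> by simp
  moreover have "\<bar>p v w (x + s *\<^sub>R v + t *\<^sub>R w) - p v w x\<bar> < e"
    using d near st by auto
  moreover have "\<bar>p w v (x + s' *\<^sub>R w + t' *\<^sub>R v) - p w v x\<bar> < e"
    using d near' st' by auto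
  ultimately show False unfolding e_def by (smt (verit) field_sum_of_halves)
qed

section \<open>Alternation and cyclic contractions\<close>

text \<open>The normalising factorial of \<open>p_form\<close> stays outside, as it does not affect
  vanishing.\<close>

definition alternation :: "nat \<Rightarrow> ((nat \<Rightarrow> 'n) \<Rightarrow> real) \<Rightarrow> (nat \<Rightarrow> 'n) \<Rightarrow> real" where
  "alternation n F a = (\<Sum>\<sigma> | \<sigma> permutes {..<n}. of_int (sign \<sigma>) * F (a \<circ> \<sigma>))"

lemma alternation_add:
  "alternation n (\<lambda>b. F b + G b) a = alternation n F a + alternation n G a"
  by (simp add: alternation_def distrib_left sum.distrib)

lemma alternation_diff:
  "alternation n (\<lambda>b. F b - G b) a = alternation n F a - alternation n G a"
  by (simp add: alternation_def right_diff_distrib sum_subtractf)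

lemma alternation_uminus:
  "alternation n (\<lambda>b. - F b) a = - alternation n F a"
  by (simp add: alternation_def sum_negf)

text \<open>Reindexing \<sigma> as \<sigma> \<circ> \<tau> multiplies its sign by that of \<tau>,
  and signs square to 1.\<close>

lemma alternation_compose:
  assumes "\<tau> permutes {..<n}"
  shows "alternation n (\<lambda>b. F (b \<circ> \<tau>)) a = of_int (sign \<tau>) * alternation n F a"
proof -
  have "alternation n F a = (\<Sum>\<sigma> | \<sigma> permutes {..<n}. of_int (sign (\<sigma> \<circ> \<tau>)) * F (a \<circ> (\<sigma> \<circ> \<tau>)))"
    unfolding alternation_def by (rule sum_permutations_compose_right[OF assms])
  also have "\<dots> = (\<Sum>\<sigma> | \<sigma> permutes {..<n}. of_int (sign \<tau>) * (of_int (sign \<sigma>) * F (a \<circ> \<sigma> \<circ> \<tau>)))"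
    using assms by (intro sum.cong refl)
      (auto simp: sign_compose permutes_imp_permutation[OF finite_lessThan] o_assoc)
  also have "\<dots> = of_int (sign \<tau>) * alternation n (\<lambda>b. F (b \<circ> \<tau>)) a"
    by (simp add: alternation_def sum_distrib_left)
  finally show ?thesis
    by (simp flip: mult.assoc of_int_mult)
qed

text \<open>A 3-cycle is even, so composing \<open>F\<close> with it or with its square does not
  change the alternation. Three times the alternation is therefore that of a function which is
  identically 0.\<close>

lemma alternation_eq_0_cyclic:
  assumes "p < n" "q < n" "r < n" "distinct [p, q, r]"
    and "\<And>b. F b + F (b(p := b q, q := b r, r := b p)) + F (b(p := b r, q := b p, r := b q)) = 0"
  shows "alternation n F a = 0"
proof -
  define \<tau> where "\<tau> = Transposition.transpose p q \<circ> Transposition.transpose q r"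
  have \<tau>: "\<tau> permutes {..<n}"
    unfolding \<tau>_def using assms by (intro permutes_compose permutes_swap_id) auto
  have "sign \<tau> = 1"
    using assms by (simp add: \<tau>_def sign_compose permutation_swap_id sign_swap_id)
  have 1: "b \<circ> \<tau> = b(p := b q, q := b r, r := b p)" for b :: "nat \<Rightarrow> 'a"
    using assms(4) by (auto simp: \<tau>_def fun_eq_iff Transposition.transpose_def)
  have 2: "b \<circ> \<tau> \<circ> \<tau> = b(p := b r, q := b p, r := b q)" for b :: "nat \<Rightarrow> 'a"
    unfolding 1 using assms(4) by (auto simp: fun_eq_iff)
  have "0 = alternation n (\<lambda>b. F b + F (b \<circ> \<tau>) + F (b \<circ> \<tau> \<circ> \<tau>)) a"
    unfolding 2 unfolding 1 assms(5) by (simp add: alternation_def)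
  also have "\<dots> = 3 * alternation n F a"
    using alternation_compose[OF \<tau>, of F a] alternation_compose[OF \<tau>, of "\<lambda>b. F (b \<circ> \<tau>)" a]
    by (simp add: alternation_add \<open>sign \<tau> = 1\<close>)
  finally show ?thesis by simp
qed

text \<open>The form in which a Bianchi identity enters: \<open>i\<close> stands for the contracted
  indices, \<open>Y\<close> for the factor that reads three of the alternated positions,
  \<open>Q\<close> for everything that does not read them.\<close>

lemma alternation_eq_0_Bianchi:
  assumes "p < n" "q < n" "r < n" "distinct [p, q, r]"
    and Y: "\<And>i x y z. Y i x y z + Y i y z x + Y i z x y = 0"
    and Q: "\<And>i b x y z. Q i (b(p := x, q := y, r := z)) = Q i b"
  shows "alternation n (\<lambda>b. \<Sum>i\<in>I. Y i (b p) (b q) (b r) * Q i b) a = 0"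
proof (rule alternation_eq_0_cyclic[OF assms(1-4)])
  fix b
  have "Y i (b p) (b q) (b r) * Q i b + Y i (b q) (b r) (b p) * Q i b + Y i (b r) (b p) (b q) * Q i b = 0" for i
    using Y[of i "b p" "b q" "b r"] by (metis distrib_right mult_zero_left)
  then show "(\<Sum>i\<in>I. Y i (b p) (b q) (b r) * Q i b)
    + (\<Sum>i\<in>I. Y i ((b(p := b q, q := b r, r := b p)) p) ((b(p := b q, q := b r, r := b p)) q)
          ((b(p := b q, q := b r, r := b p)) r) * Q i (b(p := b q, q := b r, r := b p)))
    + (\<Sum>i\<in>I. Y i ((b(p := b r, q := b p, r := b q)) p) ((b(p := b r, q := b p, r := b q)) q)
          ((b(p := b r, q := b p, r := b q)) r) * Q i (b(p := b r, q := b p, r := b q))) = 0"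
    using assms(4) by (simp add: Q flip: sum.distrib)
qed

section \<open>Traces of products of endomorphism-valued 2-forms\<close>

text \<open>The trace of a product of k endomorphisms, the j-th one being \<open>X j\<close> at the
  form indices in positions 2j and 2j + 1. The factors may depend on j so that they can be exchanged
  singly.\<close>

definition cyclic_contraction ::
  "nat \<Rightarrow> (nat \<Rightarrow> 'n \<Rightarrow> 'n \<Rightarrow> 'n::finite \<Rightarrow> 'n \<Rightarrow> real) \<Rightarrow> (nat \<Rightarrow> 'n) \<Rightarrow> real" where
  "cyclic_contraction k X b =
     (\<Sum>i \<in> {..<k} \<rightarrow>\<^sub>E UNIV. \<Prod>j<k. X j (b (2 * j)) (b (2 * j + 1)) (i j) (i (Suc j mod k)))"

lemma sum_PiE_remove:
  assumes "j \<in> J"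
  shows "(\<Sum>i \<in> J \<rightarrow>\<^sub>E B. f i) = (\<Sum>i \<in> (J - {j}) \<rightarrow>\<^sub>E B. \<Sum>e\<in>B. f (i(j := e)))"
proof -
  have J: "insert j (J - {j}) = J" using assms by auto
  have inj: "inj_on (\<lambda>(y, g). g(j := y)) (B \<times> ((J - {j}) \<rightarrow>\<^sub>E B))"
  proof (rule inj_onI; clarsimp)
    fix e g e' g'
    assume g: "g \<in> (J - {j}) \<rightarrow>\<^sub>E B" "g' \<in> (J - {j}) \<rightarrow>\<^sub>E B" and eq: "g(j := e) = g'(j := e')"
    have "g m = g' m" for m
      using g fun_cong[OF eq, of m] PiE_arb[of _ "J - {j}" "\<lambda>_. B" j] by (cases "m = j") auto
    then show "e = e' \<and> g = g'" using fun_cong[OF eq, of j] by auto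
  qed
  have "(\<Sum>i \<in> J \<rightarrow>\<^sub>E B. f i) = (\<Sum>(e, i) \<in> B \<times> ((J - {j}) \<rightarrow>\<^sub>E B). f (i(j := e)))"
    using PiE_insert_eq[of j "J - {j}" "\<lambda>_. B", unfolded J] sum.reindex[OF inj, of f]
    by (simp add: o_def case_prod_unfold)
  also have "\<dots> = (\<Sum>i \<in> (J - {j}) \<rightarrow>\<^sub>E B. \<Sum>e\<in>B. f (i(j := e)))"
    by (simp add: sum.cartesian_product[symmetric] sum.swap[of _ B])
  finally show ?thesis .
qed

text \<open>The index \<open>i j\<close> is read by just two factors: \<open>j\<close>, as its upper
  index, and the cyclic predecessor \<open>p\<close>, as its lower index. Its sum can thus be
  carried out inside.\<close>

lemma cyclic_contraction_split:
  fixes X :: "nat \<Rightarrow> 'n \<Rightarrow> 'n \<Rightarrow> 'n::finite \<Rightarrow> 'n \<Rightarrow> real"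
  assumes "p < k" "j < k" "p \<noteq> j" "Suc p mod k = j"
  shows "cyclic_contraction k X b = (\<Sum>i \<in> ({..<k} - {j}) \<rightarrow>\<^sub>E UNIV.
    (\<Sum>e\<in>UNIV. X p (b (2 * p)) (b (2 * p + 1)) (i p) e * X j (b (2 * j)) (b (2 * j + 1)) e (i (Suc j mod k))) *
    (\<Prod>m \<in> {..<k} - {p, j}. X m (b (2 * m)) (b (2 * m + 1)) (i m) (i (Suc m mod k))))"
proof -
  have sj: "Suc j mod k \<noteq> j"
    using assms by (auto simp: mod_Suc split: if_splits)
  have sm: "Suc m mod k \<noteq> j" if "m < k" "m \<noteq> p" for m
    using assms that by (auto simp: mod_Suc split: if_splits)
  have K: "insert p (insert j ({..<k} - {p, j})) = {..<k}" using assms by auto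
  have P: "(\<Prod>m<k. g m) = g p * g j * (\<Prod>m \<in> {..<k} - {p, j}. g m)" for g :: "nat \<Rightarrow> real"
    using assms(3) prod.insert[of "insert j ({..<k} - {p, j})" p g] prod.insert[of "{..<k} - {p, j}" j g]
    unfolding K by (simp add: mult.assoc)
  have rest: "(\<Prod>m \<in> {..<k} - {p, j}. X m (b (2 * m)) (b (2 * m + 1)) ((i(j := e)) m) ((i(j := e)) (Suc m mod k))) =
      (\<Prod>m \<in> {..<k} - {p, j}. X m (b (2 * m)) (b (2 * m + 1)) (i m) (i (Suc m mod k)))" for i e
    by (intro prod.cong refl) (use sm in auto)
  have "cyclic_contraction k X b = (\<Sum>i \<in> ({..<k} - {j}) \<rightarrow>\<^sub>E UNIV. \<Sum>e\<in>UNIV.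
      \<Prod>m<k. X m (b (2 * m)) (b (2 * m + 1)) ((i(j := e)) m) ((i(j := e)) (Suc m mod k)))"
    unfolding cyclic_contraction_def by (rule sum_PiE_remove) (use assms(2) in simp)
  also have "\<dots> = (\<Sum>i \<in> ({..<k} - {j}) \<rightarrow>\<^sub>E UNIV. \<Sum>e\<in>UNIV.
      X p (b (2 * p)) (b (2 * p + 1)) (i p) e * X j (b (2 * j)) (b (2 * j + 1)) e (i (Suc j mod k)) *
      (\<Prod>m \<in> {..<k} - {p, j}. X m (b (2 * m)) (b (2 * m + 1)) (i m) (i (Suc m mod k))))"
    unfolding P rest assms(4) using assms(3) sj by simp
  finally show ?thesis by (simp only: sum_distrib_right)
qed

text \<open>Each Kronecker delta in factor \<open>j\<close> carries one of its form indices into the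
  lower slot of the preceding factor. Three alternated indices then occupy exactly the slots of that
  factor which its Bianchi identity permutes.\<close>

lemma alternation_cyclic_contraction_eq_0:
  fixes X :: "nat \<Rightarrow> 'n \<Rightarrow> 'n \<Rightarrow> 'n::finite \<Rightarrow> 'n \<Rightarrow> real"
  assumes k: "k \<ge> 2" "j < k"
    and X: "\<And>m a b i d. m < k \<Longrightarrow> m \<noteq> j \<Longrightarrow> X m a b i d + X m b d i a + X m d a i b = 0"
    and Xj: "\<And>a b i d. X j a b i d = kronecker i a * P b d - kronecker i b * P a d"
  shows "alternation (2 * k) (cyclic_contraction k X) a = 0"
proof -
  \<comment> \<open>The cyclic predecessor of \<open>j\<close>, which is k - 1 for j = 0; it differs
    from \<open>j\<close> because k \<ge> 2.\<close>
  obtain p where p: "p < k" "p \<noteq> j" "Suc p mod k = j"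
  proof (cases j)
    case 0
    then show ?thesis using that[of "k - 1"] k by auto
  next
    case (Suc j')
    then show ?thesis using that[of j'] k by auto
  qed
  let ?I = "({..<k} - {j}) \<rightarrow>\<^sub>E (UNIV :: 'n set)"
  let ?rest = "\<lambda>i b. \<Prod>m \<in> {..<k} - {p, j}. X m (b (2 * m)) (b (2 * m + 1)) (i m) (i (Suc m mod k))"
  let ?Y = "\<lambda>i x y z. X p x y (i p) z"
  \<comment> \<open>A remaining factor m reads positions 2m and 2m + 1 only, disjoint from those
    belonging to \<open>p\<close> and \<open>j\<close>.\<close>
  have rest: "?rest i (b(2 * p := x, 2 * p + 1 := y, r := z)) = ?rest i b"
    if "r = 2 * j \<or> r = 2 * j + 1" for i b x y z r
    using that by (intro prod.cong refl) (auto; presburger)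
  have "alternation (2 * k) (cyclic_contraction k X) a =
    alternation (2 * k) (\<lambda>b.
      (\<Sum>i\<in>?I. ?Y i (b (2 * p)) (b (2 * p + 1)) (b (2 * j)) * (P (b (2 * j + 1)) (i (Suc j mod k)) * ?rest i b)) -
      (\<Sum>i\<in>?I. ?Y i (b (2 * p)) (b (2 * p + 1)) (b (2 * j + 1)) * (P (b (2 * j)) (i (Suc j mod k)) * ?rest i b))) a"
  proof -
    have S: "(\<Sum>e\<in>UNIV. y e * (kronecker e u * c - kronecker e v * d)) = y u * c - y v * d"
      for y :: "'n \<Rightarrow> real" and u v c d
      by (simp add: kronecker_def right_diff_distrib sum_subtractf if_distrib[of "\<lambda>t. t * _"]
          if_distrib[of "\<lambda>t. _ * t"] cong: if_cong)
    show ?thesis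
      by (rule arg_cong[where f = "\<lambda>F. alternation (2 * k) F a"], rule ext)
        (simp add: cyclic_contraction_split[OF p(1) k(2) p(2,3)] Xj S left_diff_distrib sum_subtractf mult.assoc)
  qed
  also have "\<dots> = 0"
  proof -
    have Y: "?Y i x y z + ?Y i y z x + ?Y i z x y = 0" for i x y z
      using X[OF p(1,2)] .
    have 1: "alternation (2 * k) (\<lambda>b. \<Sum>i\<in>?I. ?Y i (b (2 * p)) (b (2 * p + 1)) (b (2 * j)) *
        (P (b (2 * j + 1)) (i (Suc j mod k)) * ?rest i b)) a = 0"
    proof (rule alternation_eq_0_Bianchi[where Q = "\<lambda>i b. P (b (2 * j + 1)) (i (Suc j mod k)) * ?rest i b"])
      show "2 * p < 2 * k" "2 * p + 1 < 2 * k" "2 * j < 2 * k" using p k by auto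
      show "distinct [2 * p, 2 * p + 1, 2 * j]" using p by (auto; presburger)
      show "?Y i x y z + ?Y i y z x + ?Y i z x y = 0" for i x y z by (rule Y)
      fix i x y z and b :: "nat \<Rightarrow> 'n"
      let ?b = "b(2 * p := x, 2 * p + 1 := y, 2 * j := z)"
      have "?b (2 * j + 1) = b (2 * j + 1)" using p by (auto; presburger)
      moreover have "?rest i ?b = ?rest i b" by (rule rest) simp
      ultimately show "P (?b (2 * j + 1)) (i (Suc j mod k)) * ?rest i ?b = P (b (2 * j + 1)) (i (Suc j mod k)) * ?rest i b"
        by (simp only:)
    qed
    have 2: "alternation (2 * k) (\<lambda>b. \<Sum>i\<in>?I. ?Y i (b (2 * p)) (b (2 * p + 1)) (b (2 * j + 1)) *
        (P (b (2 * j)) (i (Suc j mod k)) * ?rest i b)) a = 0"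
    proof (rule alternation_eq_0_Bianchi[where Q = "\<lambda>i b. P (b (2 * j)) (i (Suc j mod k)) * ?rest i b"])
      show "2 * p < 2 * k" "2 * p + 1 < 2 * k" "2 * j + 1 < 2 * k" using p k by auto
      show "distinct [2 * p, 2 * p + 1, 2 * j + 1]" using p by (auto; presburger)
      show "?Y i x y z + ?Y i y z x + ?Y i z x y = 0" for i x y z by (rule Y)
      fix i x y z and b :: "nat \<Rightarrow> 'n"
      let ?b = "b(2 * p := x, 2 * p + 1 := y, 2 * j + 1 := z)"
      have "?b (2 * j) = b (2 * j)" using p by (auto; presburger)
      moreover have "?rest i ?b = ?rest i b" by (rule rest) simp
      ultimately show "P (?b (2 * j)) (i (Suc j mod k)) * ?rest i ?b = P (b (2 * j)) (i (Suc j mod k)) * ?rest i b"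
        by (simp only:)
    qed
    show ?thesis unfolding alternation_diff 1 2 by simp
  qed
  finally show ?thesis .
qed

lemma cyclic_contraction_add:
  assumes "j < k"
    and "\<And>a b i d. X j a b i d = Y j a b i d + Z j a b i d"
    and "\<And>m. m < k \<Longrightarrow> m \<noteq> j \<Longrightarrow> Y m = X m" "\<And>m. m < k \<Longrightarrow> m \<noteq> j \<Longrightarrow> Z m = X m"
  shows "cyclic_contraction k X b = cyclic_contraction k Y b + cyclic_contraction k Z b"
proof -
  have P: "(\<Prod>m<k. g m) = g j * (\<Prod>m \<in> {..<k} - {j}. g m)" for g :: "nat \<Rightarrow> real"
    using assms(1) by (simp add: prod.remove)
  have "(\<Prod>m \<in> {..<k} - {j}. Y m (b (2 * m)) (b (2 * m + 1)) (i m) (i (Suc m mod k))) =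
      (\<Prod>m \<in> {..<k} - {j}. X m (b (2 * m)) (b (2 * m + 1)) (i m) (i (Suc m mod k)))"
    "(\<Prod>m \<in> {..<k} - {j}. Z m (b (2 * m)) (b (2 * m + 1)) (i m) (i (Suc m mod k))) =
      (\<Prod>m \<in> {..<k} - {j}. X m (b (2 * m)) (b (2 * m + 1)) (i m) (i (Suc m mod k)))" for i
    by (intro prod.cong refl; use assms(3,4) in auto)+
  then show ?thesis
    unfolding cyclic_contraction_def P by (simp add: assms(2) distrib_right sum.distrib)
qed

lemma alternation_cyclic_contraction_replace:
  fixes R W :: "'n \<Rightarrow> 'n \<Rightarrow> 'n::finite \<Rightarrow> 'n \<Rightarrow> real"
  assumes "k \<ge> 2"
    and R: "\<And>a b i d. R a b i d + R b d i a + R d a i b = 0"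
    and W: "\<And>a b i d. W a b i d + W b d i a + W d a i b = 0"
    and S: "\<And>a b i d. R a b i d = W a b i d + (kronecker i a * P b d - kronecker i b * P a d)"
  shows "alternation (2 * k) (cyclic_contraction k (\<lambda>_. W)) a = alternation (2 * k) (cyclic_contraction k (\<lambda>_. R)) a"
proof -
  \<comment> \<open>Intermediate products with \<open>W\<close> in the first \<open>m\<close> places
    and \<open>R\<close> in the others. At each stage the factors around S are a mixture of both, so
    both must satisfy the Bianchi identity.\<close>
  have "alternation (2 * k) (cyclic_contraction k (\<lambda>j. if j < m then W else R)) a =
      alternation (2 * k) (cyclic_contraction k (\<lambda>_. R)) a" if "m \<le> k" for m
    using that
  proof (induction m)
    case (Suc m)
    let ?Z = "(\<lambda>j. if j < m then W else R)(m := \<lambda>a b i d. kronecker i a * P b d - kronecker i b * P a d)"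
    have "alternation (2 * k) (cyclic_contraction k ?Z) a = 0"
      by (rule alternation_cyclic_contraction_eq_0[where j = m]) (use Suc assms in auto)
    moreover have "cyclic_contraction k (\<lambda>j. if j < m then W else R) b =
        cyclic_contraction k (\<lambda>j. if j < Suc m then W else R) b + cyclic_contraction k ?Z b" for b
      by (rule cyclic_contraction_add[where j = m]) (use Suc.prems S in auto)
    then have "cyclic_contraction k (\<lambda>j. if j < m then W else R) =
        (\<lambda>b. cyclic_contraction k (\<lambda>j. if j < Suc m then W else R) b + cyclic_contraction k ?Z b)"
      by blast
    ultimately show ?case using Suc by (simp add: alternation_add)
  qed simp
  moreover have "cyclic_contraction k (\<lambda>j. if j < k then W else R) = cyclic_contraction k (\<lambda>_. W)"
    unfolding cyclic_contraction_def by (intro ext sum.cong prod.cong refl) simp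
  ultimately show ?thesis by (metis order_refl)
qed

section \<open>Reversal of the trace\<close>

lemma involution_permutes:
  assumes "\<And>x. f (f x) = x" "\<And>x. x \<notin> S \<Longrightarrow> f x = x"
  shows "f permutes S"
  unfolding permutes_def using assms by metis

text \<open>In the proof, \<open>e\<close> reverses the even positions and \<open>s\<close> swaps
  the two members of each pair, so \<open>s \<circ> e \<circ> s\<close> reverses the odd positions.
  The two reversals are conjugate, hence of equal sign, and their product is even without any
  counting of inversions.\<close>

lemma reverse_pairs_permutation:
  obtains \<rho> where "\<rho> permutes {..<2 * k}" "sign \<rho> = 1"
    "\<And>j. j < k \<Longrightarrow> \<rho> (2 * j) = 2 * (k - Suc j)"
    "\<And>j. j < k \<Longrightarrow> \<rho> (2 * j + 1) = 2 * (k - Suc j) + 1"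
proof
  define e where "e m = (if even m \<and> m < 2 * k then 2 * (k - Suc (m div 2)) else m)" for m
  define s where "s m = (if m < 2 * k then if even m then Suc m else m - 1 else m)" for m
  have e: "e permutes {..<2 * k}"
    by (rule involution_permutes) (auto simp: e_def)
  have ss: "s (s m) = m" for m
    by (auto simp: s_def elim!: evenE oddE)
  have s: "s permutes {..<2 * k}"
    by (rule involution_permutes) (auto simp: ss, auto simp: s_def)
  have perm: "permutation e" "permutation s"
    using e s permutes_imp_permutation by blast+
  show "e \<circ> (s \<circ> e \<circ> s) permutes {..<2 * k}"
    by (intro permutes_compose e s)
  show "sign (e \<circ> (s \<circ> e \<circ> s)) = 1"
    using perm by (simp add: sign_compose permutation_compose mult.assoc[symmetric])
      (metis mult.assoc mult.commute mult_1 sign_idempotent)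
  show "(e \<circ> (s \<circ> e \<circ> s)) (2 * j) = 2 * (k - Suc j)" if "j < k" for j
    using that by (simp add: e_def s_def)
  show "(e \<circ> (s \<circ> e \<circ> s)) (2 * j + 1) = 2 * (k - Suc j) + 1" if "j < k" for j
    using that by (simp add: e_def s_def)
qed

text \<open>With every factor written as B G, the trace is a double sum over the upper indices
  \<open>i\<close> and the indices \<open>f\<close> between B and G. Running through the cycle
  backwards while exchanging \<open>i\<close> and \<open>f\<close> transposes each B and each G;
  each of the k factors B contributes one sign.\<close>

lemma cyclic_contraction_skew_adjoint:
  fixes B :: "'n \<Rightarrow> 'n \<Rightarrow> 'n::finite \<Rightarrow> 'n \<Rightarrow> real" and G :: "'n \<Rightarrow> 'n \<Rightarrow> real"
  assumes B: "\<And>a b i f. B a b i f = - B a b f i" and G: "\<And>i j. G i j = G j i"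
    and b': "\<And>j. j < k \<Longrightarrow> b' (2 * j) = b (2 * (k - Suc j))"
      "\<And>j. j < k \<Longrightarrow> b' (2 * j + 1) = b (2 * (k - Suc j) + 1)"
  shows "cyclic_contraction k (\<lambda>_ a b i d. \<Sum>f\<in>UNIV. B a b i f * G f d) b' =
    (- 1) ^ k * cyclic_contraction k (\<lambda>_ a b i d. \<Sum>f\<in>UNIV. B a b i f * G f d) b"
proof -
  let ?E = "{..<k} \<rightarrow>\<^sub>E (UNIV :: 'n set)"
  define T where "T b i f = (\<Prod>j<k. B (b (2 * j)) (b (2 * j + 1)) (i j) (f j)) *
    (\<Prod>j<k. G (f j) (i (Suc j mod k)))" for b i f
  have ctr: "cyclic_contraction k (\<lambda>_ a b i d. \<Sum>f\<in>UNIV. B a b i f * G f d) b =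
      (\<Sum>(i, f) \<in> ?E \<times> ?E. T b i f)" for b
    unfolding cyclic_contraction_def T_def
    by (simp add: prod_sum_PiE sum.cartesian_product prod.distrib)
  \<comment> \<open>The restriction keeps \<open>r i\<close> in the extensional function space, on
    which \<open>r\<close> is an involution.\<close>
  define r where "r i = restrict (\<lambda>j. i (k - Suc j)) {..<k}" for i :: "nat \<Rightarrow> 'n"
  have r: "r i j = i (k - Suc j)" if "j < k" for i j
    using that by (simp add: r_def)
  have rE: "r i \<in> ?E" for i by (auto simp: r_def)
  have rr: "r (r i) = i" if "i \<in> ?E" for i
  proof (rule ext)
    show "r (r i) j = i j" for j
    proof (cases "j < k")
      case True
      then show ?thesis by (simp add: r)
    next
      case False
      then show ?thesis using PiE_arb[OF that, of j] by (simp add: r_def)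
    qed
  qed
  have T: "T b' (r f) (r i) = (- 1) ^ k * T b i f" for i f
  proof -
    have "(\<Prod>j<k. B (b' (2 * j)) (b' (2 * j + 1)) (r f j) (r i j)) =
        (\<Prod>j<k. (\<lambda>l. B (b (2 * l)) (b (2 * l + 1)) (f l) (i l)) (k - Suc j))"
      by (intro prod.cong refl) (simp add: b'[simplified] b' r)
    also have "\<dots> = (\<Prod>l<k. B (b (2 * l)) (b (2 * l + 1)) (f l) (i l))"
      by (rule prod.nat_diff_reindex)
    also have "\<dots> = (\<Prod>l<k. - 1 * B (b (2 * l)) (b (2 * l + 1)) (i l) (f l))"
      by (intro prod.cong refl, subst B) simp
    also have "\<dots> = (- 1) ^ k * (\<Prod>l<k. B (b (2 * l)) (b (2 * l + 1)) (i l) (f l))"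
      by (simp only: prod.distrib prod_constant card_lessThan)
    finally have 1: "(\<Prod>j<k. B (b' (2 * j)) (b' (2 * j + 1)) (r f j) (r i j)) = \<dots>" .
    \<comment> \<open>Reversal sends vertex j of the cycle to k - 1 - j, hence the edge from j to j
      + 1 to the edge from \<open>h j\<close> to \<open>h j\<close> + 1, modulo k. The factors G sit
      on the edges.\<close>
    define h where "h j = k - Suc (Suc j mod k)" for j
    have h: "h j < k" "Suc (h j) mod k = k - Suc j" if "j < k" for j
      using that by (auto simp: h_def mod_Suc split: if_splits)
    have hh: "h (h j) = j" if "j < k" for j
      using h[OF that] that by (simp add: h_def)
    have "(\<Prod>j<k. G (r i j) (r f (Suc j mod k))) = (\<Prod>j<k. G (f (h j)) (i (Suc (h j) mod k)))"
    proof (intro prod.cong refl)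
      fix j assume "j \<in> {..<k}"
      then have "r i j = i (Suc (h j) mod k)" "r f (Suc j mod k) = f (h j)"
        by (simp_all add: r h(2)) (simp add: h_def)
      then show "G (r i j) (r f (Suc j mod k)) = G (f (h j)) (i (Suc (h j) mod k))"
        by (simp only:) (rule G)
    qed
    also have "\<dots> = (\<Prod>l<k. G (f l) (i (Suc l mod k)))"
      by (rule prod.reindex_bij_witness[where i = h and j = h]) (use h hh in auto)
    finally show ?thesis unfolding T_def 1 by simp
  qed
  have T': "T b' i f = (- 1) ^ k * T b (r f) (r i)" if "i \<in> ?E" "f \<in> ?E" for i f
    using T[of "r i" "r f"] by (simp only: rr[OF that(1)] rr[OF that(2)])
  have "(\<Sum>(i, f) \<in> ?E \<times> ?E. T b' i f) = (\<Sum>(i, f) \<in> ?E \<times> ?E. (- 1) ^ k * T b i f)"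
    by (rule sum.reindex_bij_witness[where i = "\<lambda>(i, f). (r f, r i)" and j = "\<lambda>(i, f). (r f, r i)"])
      (use rE rr T' in \<open>auto simp del: PiE_iff\<close>)
  then show ?thesis
    unfolding ctr by (simp add: sum_distrib_left case_prod_unfold)
qed

lemma alternation_cyclic_contraction_skew_adjoint:
  fixes B :: "'n \<Rightarrow> 'n \<Rightarrow> 'n::finite \<Rightarrow> 'n \<Rightarrow> real" and G :: "'n \<Rightarrow> 'n \<Rightarrow> real"
  assumes "\<And>a b i f. B a b i f = - B a b f i" "\<And>i j. G i j = G j i" "odd k"
  shows "alternation (2 * k) (cyclic_contraction k (\<lambda>_ a b i d. \<Sum>f\<in>UNIV. B a b i f * G f d)) a = 0"
proof -
  let ?F = "cyclic_contraction k (\<lambda>_ a b i d. \<Sum>f\<in>UNIV. B a b i f * G f d)"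
  obtain \<rho> where \<rho>: "\<rho> permutes {..<2 * k}" "sign \<rho> = 1"
    "\<And>j. j < k \<Longrightarrow> \<rho> (2 * j) = 2 * (k - Suc j)"
    "\<And>j. j < k \<Longrightarrow> \<rho> (2 * j + 1) = 2 * (k - Suc j) + 1"
    by (rule reverse_pairs_permutation[of k]) blast
  have "?F (b \<circ> \<rho>) = - ?F b" for b
  proof -
    have "?F (b \<circ> \<rho>) = (- 1) ^ k * ?F b"
      by (rule cyclic_contraction_skew_adjoint[OF assms(1,2)]) (simp_all only: o_apply \<rho>(3,4))
    then show ?thesis using \<open>odd k\<close> by simp
  qed
  then have "alternation (2 * k) ?F a = - alternation (2 * k) ?F a"
    using alternation_compose[OF \<rho>(1), of ?F a] by (simp add: \<rho>(2) alternation_uminus)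
  then show ?thesis by simp
qed

section \<open>Charts and coordinate frames\<close>

locale manifold =
  fixes M :: "'a topology" and A :: "('a, 'n::finite) chart set"
  assumes smooth_manifold: "smooth_manifold M A"
begin

lemma openin_chart: "c \<in> A \<Longrightarrow> openin M (fst c)"
  using smooth_manifold by (auto simp: smooth_manifold_def)

lemma inj_on_chart: "c \<in> A \<Longrightarrow> inj_on (snd c) (fst c)"
proof -
  assume c: "c \<in> A"
  then have "homeomorphic_map (subtopology M (fst c)) (top_of_set (snd c ` fst c)) (snd c)"
    using smooth_manifold unfolding smooth_manifold_def by blast
  from homeomorphic_imp_injective_map[OF this] show ?thesis
    using openin_subset[OF openin_chart[OF c]] by (simp add: Int_absorb1)
qed

lemma chart_inv_chart: "c \<in> A \<Longrightarrow> x \<in> fst c \<Longrightarrow> chart_inv c (snd c x) = x"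
  unfolding chart_inv_def using inj_on_chart by (rule inv_into_f_f)

lemma chart_chart_inv: "y \<in> snd c ` U \<Longrightarrow> U \<subseteq> fst c \<Longrightarrow> snd c (chart_inv c y) = y"
  unfolding chart_inv_def by (rule f_inv_into_f) blast

lemma chart_inv_in:
  assumes "c \<in> A" "y \<in> snd c ` U" "U \<subseteq> fst c"
  shows "chart_inv c y \<in> U"
  using assms(2)
proof (rule imageE)
  fix x assume "y = snd c x" "x \<in> U"
  then show "chart_inv c y \<in> U" using chart_inv_chart[OF assms(1), of x] assms(3) by (simp add: subset_iff)
qed

lemma open_chart_image:
  assumes "c \<in> A" "openin M U" "U \<subseteq> fst c"
  shows "open (snd c ` U)"
proof -
  have h: "homeomorphic_map (subtopology M (fst c)) (top_of_set (snd c ` fst c)) (snd c)"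
    and o: "open (snd c ` fst c)"
    using smooth_manifold assms(1) unfolding smooth_manifold_def by blast+
  have "openin (subtopology M (fst c)) U"
    using assms by (simp add: openin_open_subtopology openin_chart)
  with homeomorphic_imp_open_map[OF h] have "openin (top_of_set (snd c ` fst c)) (snd c ` U)"
    by (simp add: open_map_def)
  then show ?thesis using o openin_open_eq by blast
qed

lemma smooth_transition:
  "c \<in> A \<Longrightarrow> c' \<in> A \<Longrightarrow> smooth_on (snd c ` (fst c \<inter> fst c')) (snd c' \<circ> chart_inv c)"
  using smooth_manifold unfolding smooth_manifold_def by blast

text \<open>Transition maps are smooth, so over a part of one chart domain smoothness needs to be
  checked in that chart only.\<close>

lemma smooth_on_change_chart:
  fixes h :: "'a \<Rightarrow> 'b::real_normed_vector"
  assumes c: "c \<in> A" "c' \<in> A" and U: "openin M U" "U \<subseteq> fst c" "U \<subseteq> fst c'"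
    and h: "smooth_on (snd c ` U) (h \<circ> chart_inv c)"
  shows "smooth_on (snd c' ` U) (h \<circ> chart_inv c')"
proof (rule smooth_on_cong)
  show o: "open (snd c' ` U)" using c U by (simp add: open_chart_image)
  show "smooth_on (snd c' ` U) (\<lambda>y. (h \<circ> chart_inv c) ((snd c \<circ> chart_inv c') y))"
  proof (rule smooth_on_compose[OF o _ _ _ h])
    show "open (snd c ` U)" using c U by (simp add: open_chart_image)
    show "(snd c \<circ> chart_inv c') ` snd c' ` U \<subseteq> snd c ` U"
      using chart_inv_in[OF c(2) _ U(3)] by auto
    show "smooth_on (snd c' ` U) (snd c \<circ> chart_inv c')"
      by (rule smooth_on_subset[OF smooth_transition[OF c(2,1)]]) (use U in auto)
  qed
  show "(h \<circ> chart_inv c) ((snd c \<circ> chart_inv c') y) = (h \<circ> chart_inv c') y" if "y \<in> snd c' ` U" for y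
    using chart_inv_chart[OF c(1)] chart_inv_in[OF c(2) that U(3)] U(2) by auto
qed

lemma smooth_funI:
  assumes "c \<in> A" "openin M U" "U \<subseteq> fst c" "smooth_on (snd c ` U) (f \<circ> chart_inv c)"
  shows "smooth_fun A U f"
  unfolding smooth_fun_def
proof
  fix c' assume c': "c' \<in> A"
  show "smooth_on (snd c' ` (U \<inter> fst c')) (f \<circ> chart_inv c')"
  proof (rule smooth_on_change_chart[OF assms(1) c'])
    show "openin M (U \<inter> fst c')" using assms c' openin_chart by blast
    show "smooth_on (snd c ` (U \<inter> fst c')) (f \<circ> chart_inv c)"
      by (rule smooth_on_subset[OF assms(4)]) auto
  qed (use assms in auto)
qed

lemma transition_has_derivative:
  assumes "c \<in> A" "c' \<in> A" "x \<in> fst c" "x \<in> fst c'"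
  shows "((snd c' \<circ> chart_inv c) has_derivative transition_deriv c c' x) (at (snd c x))"
  unfolding transition_deriv_def chart_deriv_def
  by (rule smooth_on_has_derivative[OF smooth_transition[OF assms(1,2)]]) (use assms in auto)

lemma linear_transition_deriv:
  "c \<in> A \<Longrightarrow> c' \<in> A \<Longrightarrow> x \<in> fst c \<Longrightarrow> x \<in> fst c' \<Longrightarrow> linear (transition_deriv c c' x)"
  using has_derivative_linear[OF transition_has_derivative] .

lemma transition_deriv_cocycle:
  assumes c: "c \<in> A" "c' \<in> A" "c'' \<in> A" and x: "x \<in> fst c" "x \<in> fst c'" "x \<in> fst c''"
  shows "transition_deriv c c'' x v = transition_deriv c' c'' x (transition_deriv c c' x v)"
proof -
  let ?U = "fst c \<inter> fst c' \<inter> fst c''"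
  have x': "(snd c' \<circ> chart_inv c) (snd c x) = snd c' x" using chart_inv_chart c x by simp
  have "((\<lambda>y. (snd c'' \<circ> chart_inv c') ((snd c' \<circ> chart_inv c) y)) has_derivative
      (\<lambda>v. transition_deriv c' c'' x (transition_deriv c c' x v))) (at (snd c x))"
    by (rule has_derivative_compose[OF transition_has_derivative[OF c(1,2) x(1,2)]])
      (simp only: x' transition_has_derivative[OF c(2,3) x(2,3)])
  then have "((snd c'' \<circ> chart_inv c) has_derivative
      (\<lambda>v. transition_deriv c' c'' x (transition_deriv c c' x v))) (at (snd c x))"
  proof (rule has_derivative_transform_within_open)
    show "open (snd c ` ?U)"
      by (intro open_chart_image[OF c(1)] openin_Int openin_chart c) auto
    show "snd c x \<in> snd c ` ?U" using x by auto
    show "(snd c'' \<circ> chart_inv c') ((snd c' \<circ> chart_inv c) y) = (snd c'' \<circ> chart_inv c) y"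
      if "y \<in> snd c ` ?U" for y
    proof -
      have "chart_inv c y \<in> ?U" by (rule chart_inv_in[OF c(1) that]) auto
      then show ?thesis using chart_inv_chart[OF c(2)] by simp
    qed
  qed
  from has_derivative_unique[OF this transition_has_derivative[OF c(1,3) x(1,3)]] show ?thesis
    by (simp add: fun_eq_iff)
qed

text \<open>Read in \<open>c\<close>, the component in another chart is a derivative of the
  transition map in a fixed direction, hence smooth; the transformation law is the cocycle
  rule.\<close>

lemma vector_field_coord_field:
  assumes c: "c \<in> A"
  shows "vector_field A (fst c) (coord_field c a)"
  unfolding vector_field_def
proof (intro conjI ballI)
  fix c' assume c': "c' \<in> A"
  let ?U = "fst c \<inter> fst c'"
  show "smooth_on (snd c' ` ?U) (coord_field c a c' \<circ> chart_inv c')"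
  proof (rule smooth_on_change_chart[OF c c'])
    show U: "openin M ?U" using c c' openin_chart by blast
    show "smooth_on (snd c ` ?U) (coord_field c a c' \<circ> chart_inv c)"
    proof (rule smooth_on_cong)
      show "open (snd c ` ?U)" using c U by (simp add: open_chart_image)
      show "smooth_on (snd c ` ?U) (\<lambda>y. frechet_derivative (snd c' \<circ> chart_inv c) (at y) (axis a 1))"
        by (rule smooth_on_frechet_derivative[OF smooth_transition[OF c c']])
    qed (auto simp: coord_field_def transition_deriv_def chart_deriv_def chart_inv_chart[OF c])
  qed auto
next
  fix c' c'' x assume "c' \<in> A" "c'' \<in> A" "x \<in> fst c \<inter> fst c' \<inter> fst c''"
  then show "coord_field c a c'' x = transition_deriv c' c'' x (coord_field c a c' x)"
    unfolding coord_field_def using transition_deriv_cocycle c by blast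
qed

lemma coord_field_chart:
  assumes c: "c \<in> A" "x \<in> fst c"
  shows "coord_field c a c x = axis a 1"
proof -
  have "((\<lambda>y. y) has_derivative (\<lambda>v. v)) (at (snd c x))" by simp
  then have "((snd c \<circ> chart_inv c) has_derivative (\<lambda>v. v)) (at (snd c x))"
    by (rule has_derivative_transform_within_open[OF _ open_chart_image[OF c(1) openin_chart[OF c(1)] order_refl]])
      (use c in \<open>auto simp: chart_chart_inv\<close>)
  then show ?thesis
    by (simp add: coord_field_def transition_deriv_def chart_deriv_def frechet_derivative_eqI)
qed

lemma vector_field_transition:
  "vector_field A U X \<Longrightarrow> c \<in> A \<Longrightarrow> c' \<in> A \<Longrightarrow> x \<in> U \<inter> fst c \<inter> fst c' \<Longrightarrow>
    X c' x = transition_deriv c c' x (X c x)"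
  unfolding vector_field_def by blast

lemma vector_field_add:
  assumes "openin M U" "vector_field A U X" "vector_field A U Y"
  shows "vector_field A U (\<lambda>c x. X c x + Y c x)"
  unfolding vector_field_def
proof (intro conjI ballI)
  fix c assume c: "c \<in> A"
  have "open (snd c ` (U \<inter> fst c))" by (rule open_chart_image[OF c openin_Int[OF assms(1) openin_chart[OF c]]]) simp
  from smooth_on_add[OF this, of "X c \<circ> chart_inv c" "Y c \<circ> chart_inv c"]
  show "smooth_on (snd c ` (U \<inter> fst c)) ((\<lambda>x. X c x + Y c x) \<circ> chart_inv c)"
    using assms c by (simp add: vector_field_def o_def)
next
  fix c c' x assume "c \<in> A" "c' \<in> A" "x \<in> U \<inter> fst c \<inter> fst c'"
  then show "X c' x + Y c' x = transition_deriv c c' x (X c x + Y c x)"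
    using vector_field_transition[OF assms(2)] vector_field_transition[OF assms(3)]
      linear_add[OF linear_transition_deriv] by (metis IntD1 IntD2)
qed

lemma vector_field_scale:
  assumes "openin M U" "smooth_fun A U f" "vector_field A U X"
  shows "vector_field A U (\<lambda>c x. f x *\<^sub>R X c x)"
  unfolding vector_field_def
proof (intro conjI ballI)
  fix c assume c: "c \<in> A"
  have "open (snd c ` (U \<inter> fst c))" by (rule open_chart_image[OF c openin_Int[OF assms(1) openin_chart[OF c]]]) simp
  from smooth_on_scaleR[OF this, of "f \<circ> chart_inv c" "X c \<circ> chart_inv c"]
  show "smooth_on (snd c ` (U \<inter> fst c)) ((\<lambda>x. f x *\<^sub>R X c x) \<circ> chart_inv c)"
    using assms c by (simp add: vector_field_def smooth_fun_def o_def)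
next
  fix c c' x assume "c \<in> A" "c' \<in> A" "x \<in> U \<inter> fst c \<inter> fst c'"
  then show "f x *\<^sub>R X c' x = transition_deriv c c' x (f x *\<^sub>R X c x)"
    using vector_field_transition[OF assms(3)] linear_cmul[OF linear_transition_deriv]
    by (metis IntD1 IntD2)
qed

lemma vf_eq_onI:
  assumes "c \<in> A" "U \<subseteq> fst c" "vector_field A U X" "vector_field A U Y"
    and "\<And>x. x \<in> U \<Longrightarrow> X c x = Y c x"
  shows "vf_eq_on A U X Y"
  unfolding vf_eq_on_def
proof (intro ballI)
  fix c' x assume "c' \<in> A" "x \<in> U \<inter> fst c'"
  then have "X c' x = transition_deriv c c' x (X c x)" "Y c' x = transition_deriv c c' x (Y c x)"
    using assms(1-4) unfolding vector_field_def by blast+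
  then show "X c' x = Y c' x" using assms(5) \<open>x \<in> U \<inter> fst c'\<close> by simp
qed

end

section \<open>Connections over a single chart domain\<close>

locale manifold_chart = manifold M A for M :: "'a topology" and A :: "('a, 'n::finite) chart set" +
  fixes c :: "('a, 'n) chart"
  assumes c: "c \<in> A"
begin

abbreviation "U \<equiv> fst c"
abbreviation frame :: "'n \<Rightarrow> ('a, 'n) vfield" ("\<partial>") where "\<partial> \<equiv> coord_field c"

lemmas openU = openin_chart[OF c] and frame[simp] = vector_field_coord_field[OF c]

lemma chart_derivI:
  assumes "((f \<circ> chart_inv c) has_derivative f') (at (snd c x))"
  shows "chart_deriv c f x = f'"
  unfolding chart_deriv_def by (rule frechet_derivative_eqI[OF assms])

lemma open_image: "open (snd c ` U)"
  using open_chart_image[OF c openU] by simp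

lemma smooth_fun_one_form:
  assumes "one_form A (topspace M) \<Upsilon>"
  shows "smooth_fun A U (\<lambda>x. \<Upsilon> c x $ b)"
proof (rule smooth_funI[OF c openU order_refl])
  have "smooth_on (snd c ` (topspace M \<inter> U)) (\<Upsilon> c \<circ> chart_inv c)"
    using assms c unfolding one_form_def by blast
  then have "smooth_on (snd c ` U) (\<Upsilon> c \<circ> chart_inv c)"
    by (simp only: Int_absorb1[OF openin_subset[OF openU]])
  from smooth_on_bounded_linear[OF open_image bounded_linear_vec_nth this]
  show "smooth_on (snd c ` U) ((\<lambda>x. \<Upsilon> c x $ b) \<circ> chart_inv c)" by (simp add: o_def)
qed

lemma vf_eq_on_chart: "vf_eq_on A U X Y \<Longrightarrow> x \<in> U \<Longrightarrow> X c x = Y c x"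
  using c unfolding vf_eq_on_def by blast

text \<open>Fields that agree on \<open>U\<close> may still differ as functions, so an argument of
  \<open>nabla\<close> cannot simply be rewritten. The locality axiom, with all three of its open
  sets equal to \<open>U\<close>, takes the place of rewriting.\<close>

lemma connection_cong:
  assumes "affine_connection M A nabla" "vector_field A U X" "vector_field A U X'"
    "vector_field A U Y" "vector_field A U Y'" "vf_eq_on A U X X'" "vf_eq_on A U Y Y'"
  shows "vf_eq_on A U (nabla U X Y) (nabla U X' Y')"
  by (rule assms(1)[unfolded affine_connection_def, THEN conjunct2, THEN conjunct1, rule_format, where U = U and V = U]) (use assms openU in simp)

lemma connection_vector_field:
  assumes "affine_connection M A nabla" "vector_field A U X" "vector_field A U Y"
  shows "vector_field A U (nabla U X Y)"
  by (rule assms(1)[unfolded affine_connection_def, THEN conjunct1, rule_format]) (use assms openU in simp)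

lemma connection_add:
  assumes "affine_connection M A nabla" "vector_field A U X" "vector_field A U Y" "vector_field A U Y'" "x \<in> U"
  shows "nabla U X (\<lambda>c x. Y c x + Y' c x) c x = nabla U X Y c x + nabla U X Y' c x"
proof -
  have "vf_eq_on A U (nabla U X (\<lambda>c x. Y c x + Y' c x)) (\<lambda>c x. nabla U X Y c x + nabla U X Y' c x)"
    by (rule assms(1)[unfolded affine_connection_def, THEN conjunct2, THEN conjunct2, THEN conjunct2, THEN conjunct2, THEN conjunct1, rule_format]) (use assms openU in simp)
  from vf_eq_on_chart[OF this assms(5)] show ?thesis .
qed

lemma connection_scale:
  assumes "affine_connection M A nabla" "vector_field A U X" "vector_field A U Y" "smooth_fun A U f" "x \<in> U"
  shows "nabla U X (\<lambda>c x. f x *\<^sub>R Y c x) c x =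
    f x *\<^sub>R nabla U X Y c x + chart_deriv c f x (X c x) *\<^sub>R Y c x"
proof -
  have "vf_eq_on A U (nabla U X (\<lambda>c x. f x *\<^sub>R Y c x))
      (\<lambda>c x. f x *\<^sub>R nabla U X Y c x + chart_deriv c f x (X c x) *\<^sub>R Y c x)"
    by (rule assms(1)[unfolded affine_connection_def, THEN conjunct2, THEN conjunct2, THEN conjunct2, THEN conjunct2, THEN conjunct2, rule_format]) (use assms openU in simp)
  from vf_eq_on_chart[OF this assms(5)] show ?thesis .
qed

lemma vf_eq_on_refl: "vf_eq_on A U X X"
  by (simp add: vf_eq_on_def)

text \<open>Coordinate fields are constant in their own chart, so their bracket vanishes there: this
  is the symmetry of the Christoffel symbols.\<close>

lemma frame_torsion_free:
  assumes "affine_connection M A nabla" "torsion_free M A nabla"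
  shows "vf_eq_on A U (nabla U (\<partial> a) (\<partial> b)) (nabla U (\<partial> b) (\<partial> a))"
proof (rule vf_eq_onI[OF c order_refl])
  fix x assume x: "x \<in> U"
  have D: "chart_deriv c (\<partial> d c) x = (\<lambda>_. 0)" for d
  proof (rule chart_derivI)
    have "((\<lambda>_. axis d 1) has_derivative (\<lambda>_. 0)) (at (snd c x))" by simp
    then show "((\<partial> d c \<circ> chart_inv c) has_derivative (\<lambda>_. 0)) (at (snd c x))"
      by (rule has_derivative_transform_within_open[OF _ open_image])
        (use x coord_field_chart[OF c] chart_inv_in[OF c _ order_refl] in simp_all)
  qed
  have "vf_eq_on A U (\<lambda>c x. nabla U (\<partial> a) (\<partial> b) c x - nabla U (\<partial> b) (\<partial> a) c x) (lie_bracket (\<partial> a) (\<partial> b))"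
    using assms openU unfolding torsion_free_def by simp
  from vf_eq_on_chart[OF this x] show "nabla U (\<partial> a) (\<partial> b) c x = nabla U (\<partial> b) (\<partial> a) c x"
    by (simp add: lie_bracket_def D)
qed (use assms in \<open>auto intro: connection_vector_field\<close>)

end

section \<open>Curvature in a coordinate frame\<close>

locale torsion_free_chart = manifold_chart M A c
  for M :: "'a topology" and A :: "('a, 'n::finite) chart set" and c +
  fixes nabla :: "('a, 'n) conn"
  assumes conn: "affine_connection M A nabla" and tf: "torsion_free M A nabla"
begin

abbreviation D where "D \<equiv> nabla U"

lemmas D_frame[simp] = connection_vector_field[OF conn]

lemma D_D_frame_swap: "x \<in> U \<Longrightarrow> D (\<partial> a) (D (\<partial> b) (\<partial> d)) c x = D (\<partial> a) (D (\<partial> d) (\<partial> b)) c x"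
  by (rule vf_eq_on_chart, rule connection_cong[OF conn])
    (auto intro: frame_torsion_free[OF conn tf] vf_eq_on_refl)

lemma D_frame_swap: "x \<in> U \<Longrightarrow> D (\<partial> a) (\<partial> b) c x = D (\<partial> b) (\<partial> a) c x"
  by (rule vf_eq_on_chart[OF frame_torsion_free[OF conn tf]])

text \<open>The correction terms of the two second covariant derivatives cancel by that same
  symmetry.\<close>

lemma curvature_frame:
  assumes "x \<in> U"
  shows "curvature nabla c x a b i d = (D (\<partial> a) (D (\<partial> b) (\<partial> d)) c x - D (\<partial> b) (D (\<partial> a) (\<partial> d)) c x) $ i"
proof -
  have "D (D (\<partial> a) (\<partial> b)) (\<partial> d) c x = D (D (\<partial> b) (\<partial> a)) (\<partial> d) c x"
    by (rule vf_eq_on_chart[OF connection_cong[OF conn]])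
      (auto intro: frame_torsion_free[OF conn tf] vf_eq_on_refl assms)
  then show ?thesis by (simp add: curvature_def second_cov_deriv_def)
qed

lemma curvature_skew: "curvature nabla c x a b i d = - curvature nabla c x b a i d"
  by (simp add: curvature_def)

text \<open>The six second derivatives of frame fields cancel in pairs after the two inner indices
  are exchanged.\<close>

lemma curvature_Bianchi:
  assumes "x \<in> U"
  shows "curvature nabla c x a b i d + curvature nabla c x b d i a + curvature nabla c x d a i b = 0"
  using D_D_frame_swap[OF assms, of a b d] D_D_frame_swap[OF assms, of b d a] D_D_frame_swap[OF assms, of d a b]
  by (simp add: curvature_frame[OF assms])

end

text \<open>The change has the shape of the P and \<beta> terms of a Weyl decomposition, so it can
  be absorbed there while the Weyl part stays fixed.\<close>

lemma (in manifold_chart) curvature_projective_change: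
  assumes "affine_connection M A nabla" "torsion_free M A nabla"
    and "affine_connection M A nabla'" "torsion_free M A nabla'"
    and \<Upsilon>: "one_form A (topspace M) \<Upsilon>"
    and nabla': "\<And>X Y. vector_field A U X \<Longrightarrow> vector_field A U Y \<Longrightarrow>
      vf_eq_on A U (nabla' U X Y)
        (\<lambda>c x. nabla U X Y c x + (\<Upsilon> c x \<bullet> X c x) *\<^sub>R Y c x + (\<Upsilon> c x \<bullet> Y c x) *\<^sub>R X c x)"
    and x: "x \<in> U"
  obtains Q \<gamma> where "\<And>a b. \<gamma> a b = - (Q a b - Q b a)"
    "\<And>a b i d. curvature nabla' c x a b i d =
      curvature nabla c x a b i d + (kronecker i a * Q b d - kronecker i b * Q a d) + \<gamma> a b * kronecker i d"
proof -
  interpret N: torsion_free_chart M A c nabla by unfold_locales fact+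
  interpret N': torsion_free_chart M A c nabla' by unfold_locales fact+
  \<comment> \<open>Components in the fixed chart \<open>c\<close>, taken as scalar functions on
    \<open>U\<close>; as such they may multiply fields in every chart.\<close>
  define u where "u b x = \<Upsilon> c x $ b" for b x
  define du where "du a b = chart_deriv c (u b) x (axis a 1)" for a b
  have u: "smooth_fun A U (u b)" for b
    unfolding u_def[abs_def] by (rule smooth_fun_one_form[OF \<Upsilon>])
  have fr: "\<partial> a c y = axis a 1" if "y \<in> U" for a y by (rule coord_field_chart[OF c that])
  have chg: "N'.D X Y c y = N.D X Y c y + (\<Upsilon> c y \<bullet> X c y) *\<^sub>R Y c y + (\<Upsilon> c y \<bullet> Y c y) *\<^sub>R X c y"
    if "vector_field A U X" "vector_field A U Y" "y \<in> U" for X Y y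
    using vf_eq_on_chart[OF nabla' that(3)] that by simp
  have sc: "vector_field A U (\<lambda>c x. u b x *\<^sub>R \<partial> d c x)" for b d
    by (rule vector_field_scale[OF openU u]) simp
  let ?V1 = "\<lambda>b d c x. N.D (\<partial> b) (\<partial> d) c x + u b x *\<^sub>R \<partial> d c x"
  let ?V = "\<lambda>b d c x. ?V1 b d c x + u d x *\<^sub>R \<partial> b c x"
  have V1: "vector_field A U (?V1 b d)" and V: "vector_field A U (?V b d)" for b d
    by (intro vector_field_add[OF openU] sc; simp)+
  have N'V: "vf_eq_on A U (N'.D (\<partial> b) (\<partial> d)) (?V b d)" for b d
    by (rule vf_eq_onI[OF c order_refl _ V])
      (auto simp: chg fr u_def inner_axis)
  have DV: "N.D (\<partial> a) (N'.D (\<partial> b) (\<partial> d)) c x =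
      N.D (\<partial> a) (N.D (\<partial> b) (\<partial> d)) c x
      + (u b x *\<^sub>R N.D (\<partial> a) (\<partial> d) c x + du a b *\<^sub>R axis d 1)
      + (u d x *\<^sub>R N.D (\<partial> a) (\<partial> b) c x + du a d *\<^sub>R axis b 1)" for a b d
  proof -
    have "N.D (\<partial> a) (N'.D (\<partial> b) (\<partial> d)) c x = N.D (\<partial> a) (?V b d) c x"
      by (rule vf_eq_on_chart[OF connection_cong[OF N.conn]])
        (auto intro: N'V V vf_eq_on_refl x)
    also have "\<dots> = N.D (\<partial> a) (?V1 b d) c x + N.D (\<partial> a) (\<lambda>c x. u d x *\<^sub>R \<partial> b c x) c x"
      by (rule connection_add[OF N.conn _ V1 sc x]) simp
    also have "N.D (\<partial> a) (?V1 b d) c x =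
        N.D (\<partial> a) (N.D (\<partial> b) (\<partial> d)) c x + N.D (\<partial> a) (\<lambda>c x. u b x *\<^sub>R \<partial> d c x) c x"
      by (rule connection_add[OF N.conn _ _ sc x]) simp_all
    finally show ?thesis
      by (simp add: connection_scale[OF N.conn _ _ u x] fr[OF x] du_def)
  qed
  have DDV: "N'.D (\<partial> a) (N'.D (\<partial> b) (\<partial> d)) c x $ i =
      N.D (\<partial> a) (N.D (\<partial> b) (\<partial> d)) c x $ i
      + u b x * N.D (\<partial> a) (\<partial> d) c x $ i + du a b * kronecker i d
      + u d x * N.D (\<partial> a) (\<partial> b) c x $ i + du a d * kronecker i b
      + u a x * (N.D (\<partial> b) (\<partial> d) c x $ i + u b x * kronecker i d + u d x * kronecker i b)
      + (\<Upsilon> c x \<bullet> N.D (\<partial> b) (\<partial> d) c x + 2 * u b x * u d x) * kronecker i a" for a b d i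
  proof -
    have "N'.D (\<partial> b) (\<partial> d) c x = N.D (\<partial> b) (\<partial> d) c x + u b x *\<^sub>R axis d 1 + u d x *\<^sub>R axis b 1"
      using vf_eq_on_chart[OF N'V x] by (simp add: fr[OF x])
    then show ?thesis
      by (simp add: chg x DV fr[OF x] inner_axis inner_add_right flip: u_def)
        (simp add: axis_def kronecker_def algebra_simps)
  qed
  \<comment> \<open>In index notation Q_bd = \<Upsilon>_b \<Upsilon>_d - \<nabla>_b \<Upsilon>_d,
    with the covariant derivative written out as the coordinate derivative \<open>du b d\<close>
    minus its Christoffel term. The antisymmetric part supplied for \<gamma> is the exterior
    derivative of \<Upsilon>.\<close>
  define Q where "Q b d = \<Upsilon> c x \<bullet> N.D (\<partial> b) (\<partial> d) c x + u b x * u d x - du b d" for b d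
  show thesis
  proof (rule that[of "\<lambda>a b. du a b - du b a" Q])
    show "du a b - du b a = - (Q a b - Q b a)" for a b
      using N.D_frame_swap[OF x, of a b] by (simp add: Q_def)
    show "curvature nabla' c x a b i d =
        curvature nabla c x a b i d + (kronecker i a * Q b d - kronecker i b * Q a d)
        + (du a b - du b a) * kronecker i d" for a b i d
      using N.D_frame_swap[OF x, of a b]
      by (simp add: N.curvature_frame[OF x] N'.curvature_frame[OF x] DDV Q_def) (simp add: algebra_simps)
  qed
qed

section \<open>The Weyl decomposition\<close>

lemma sum_kronecker:
  fixes f :: "'n::finite \<Rightarrow> real"
  shows "(\<Sum>i\<in>UNIV. kronecker i b * f i) = f b"
  by (simp add: kronecker_def if_distrib[of "\<lambda>t. t * _"] cong: if_cong)

lemma sum_kronecker':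
  fixes f :: "'n::finite \<Rightarrow> real"
  shows "(\<Sum>i\<in>UNIV. f i * kronecker i b) = f b"
  using sum_kronecker[of b f] by (simp add: mult.commute)

lemma kronecker_refl [simp]: "kronecker i i = 1"
  by (simp add: kronecker_def)

text \<open>Trace-freeness removes W, leaving a linear equation between P and the Ricci
  tensor.\<close>

lemma weyl_decomposition_ricci:
  fixes R :: "'n::finite \<Rightarrow> 'n \<Rightarrow> 'n \<Rightarrow> 'n \<Rightarrow> real"
  assumes "weyl_decomposition R W P \<beta>"
  shows "(\<Sum>i\<in>UNIV. R i b i d) = real CARD('n) * P b d - P d b"
proof -
  have "R i b i d = W i b i d + (P b d - kronecker i b * P i d) + \<beta> i b * kronecker i d" for i
    using assms unfolding weyl_decomposition_def by simp
  then have "(\<Sum>i\<in>UNIV. R i b i d) = (\<Sum>i\<in>UNIV. W i b i d) + (real CARD('n) * P b d - P b d) + \<beta> d b"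
    by (simp add: sum.distrib sum_subtractf sum_kronecker sum_kronecker')
  then show ?thesis
    using assms unfolding weyl_decomposition_def completely_trace_free_def by simp
qed

lemma weyl_decomposition_unique:
  fixes R :: "'n::finite \<Rightarrow> 'n \<Rightarrow> 'n \<Rightarrow> 'n \<Rightarrow> real"
  assumes "CARD('n) \<ge> 2" "weyl_decomposition R W P \<beta>" "weyl_decomposition R W' P' \<beta>'"
  shows "W = W'"
proof -
  define n where "n = real CARD('n)"
  have n: "n * n - 1 > 0"
  proof -
    have "n \<ge> 2" using assms(1) by (simp add: n_def)
    then have "n * n \<ge> 2 * 2" by (intro mult_mono) auto
    then show ?thesis by simp
  qed
  have "n * P b d - P d b = n * P' b d - P' d b" for b d
    using weyl_decomposition_ricci[OF assms(2), of b d] weyl_decomposition_ricci[OF assms(3), of b d]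
    by (simp add: n_def)
  \<comment> \<open>The difference of the two candidates becomes its own transpose when multiplied
    by n. Using this twice gives n * n times the difference equal to itself, and n * n exceeds
    1.\<close>
  then have e: "n * (P b d - P' b d) = P d b - P' d b" for b d
    by (simp add: algebra_simps)
  have "(n * n - 1) * (P b d - P' b d) = 0" for b d
  proof -
    have "n * n * (P b d - P' b d) = n * (n * (P b d - P' b d))" by simp
    also have "\<dots> = P b d - P' b d" unfolding e ..
    finally show ?thesis by (simp add: left_diff_distrib)
  qed
  then have P: "P b d = P' b d" for b d using n by (metis eq_iff_diff_eq_0 less_irrefl mult_eq_0_iff)
  then have "\<beta> a b = \<beta>' a b" for a b
    using assms(2,3) unfolding weyl_decomposition_def by simp
  with P show ?thesis
    using assms(2,3) unfolding weyl_decomposition_def by (simp add: fun_eq_iff) (metis add_right_cancel)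
qed

lemma weyl_decomposition_exists:
  fixes R :: "'n::finite \<Rightarrow> 'n \<Rightarrow> 'n \<Rightarrow> 'n \<Rightarrow> real"
  assumes "CARD('n) \<ge> 2"
    and skew: "\<And>a b i d. R a b i d = - R b a i d"
    and Bianchi: "\<And>a b i d. R a b i d + R b d i a + R d a i b = 0"
  shows "\<exists>W P \<beta>. weyl_decomposition R W P \<beta>"
proof -
  define n where "n = real CARD('n)"
  have n: "n \<ge> 2" using assms(1) by (simp add: n_def)
  then have n1: "n + 1 \<noteq> 0" "n - 1 \<noteq> 0" by auto
  define ric where "ric b d = (\<Sum>i\<in>UNIV. R i b i d)" for b d
  \<comment> \<open>The solution of ric_bd = n P_bd - P_db, with denominator n * n - 1.\<close>
  define P where "P b d = (n * ric b d + ric d b) / ((n + 1) * (n - 1))" for b d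
  define \<beta> where "\<beta> a b = - (P a b - P b a)" for a b
  define W where "W a b i d = R a b i d - (kronecker i a * P b d - kronecker i b * P a d) - \<beta> a b * kronecker i d"
    for a b i d
  have ric: "ric b d = n * P b d - P d b" for b d
    using n1 by (simp add: P_def divide_simps) (simp add: algebra_simps)
  have "(\<Sum>i\<in>UNIV. W i b i d) = 0" for b d
  proof -
    have "(\<Sum>i\<in>UNIV. W i b i d) = ric b d - (n * P b d - P b d) - \<beta> d b"
      by (simp add: W_def sum_subtractf sum_kronecker sum_kronecker' ric_def n_def)
    then show ?thesis by (simp add: ric \<beta>_def)
  qed
  moreover have "W a b i d = - W b a i d" for a b i d
    using skew[of a b i d] by (simp add: W_def \<beta>_def algebra_simps)
  then have "(\<Sum>i\<in>UNIV. W a i i d) = - (\<Sum>i\<in>UNIV. W i a i d)" for a d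
    by (metis (no_types, lifting) sum.cong sum_negf)
  moreover have "(\<Sum>i\<in>UNIV. W a b i i) = 0" for a b
  proof -
    \<comment> \<open>By the Bianchi identity the trace over the last two indices is the
      antisymmetric part of the Ricci tensor, so the choice of P already makes the third trace of W
      vanish.\<close>
    have "R a b i i = R i b i a - R i a i b" for i
      using Bianchi[of a b i i] skew[of b i i a] by simp
    then have "(\<Sum>i\<in>UNIV. R a b i i) = ric b a - ric a b"
      by (simp add: sum_subtractf ric_def)
    then have "(\<Sum>i\<in>UNIV. W a b i i) = ric b a - ric a b - (P b a - P a b) - n * \<beta> a b"
      by (simp add: W_def sum_subtractf sum_kronecker n_def)
    then show ?thesis by (simp add: ric \<beta>_def algebra_simps)
  qed
  ultimately have "weyl_decomposition R W P \<beta>"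
    unfolding weyl_decomposition_def completely_trace_free_def by (simp add: \<beta>_def W_def)
  then show ?thesis by blast
qed

text \<open>This gives the definite description its meaning. The class is the set of connections
  related to one representative, whose Weyl part serves all of them; uniqueness is applied at the
  given \<open>nabla\<close>, which shows the class to be nonempty.\<close>

lemma weyl_tensor_decomposition:
  fixes M :: "'a topology" and A :: "('a, 'n::finite) chart set"
  assumes card: "CARD('n) \<ge> 2" and M: "smooth_manifold M A" and p: "projective_structure M A p"
    and c: "c \<in> A" and x: "x \<in> fst c" and nabla: "nabla \<in> p"
  obtains P \<beta> where "weyl_decomposition (curvature nabla c x) (weyl_tensor p c x) P \<beta>"
proof -
  interpret manifold_chart M A c by unfold_locales fact+
  obtain nabla0 where nabla0: "nabla0 \<in> torsion_free_connections M A" and p: "p = projective_rel M A `` {nabla0}"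
    using p unfolding projective_structure_def by (auto elim: quotientE)
  interpret N: torsion_free_chart M A c nabla0
    using nabla0 by unfold_locales (auto simp: torsion_free_connections_def)
  obtain W P \<beta> where W: "weyl_decomposition (curvature nabla0 c x) W P \<beta>"
    using weyl_decomposition_exists[of "curvature nabla0 c x", OF card N.curvature_skew N.curvature_Bianchi[OF x]] by blast
  have all: "\<exists>P \<beta>. weyl_decomposition (curvature nabla' c x) W P \<beta>" if "nabla' \<in> p" for nabla'
  proof -
    have pr: "(nabla0, nabla') \<in> projective_rel M A" using that by (simp add: p)
    then have nabla': "affine_connection M A nabla'" "torsion_free M A nabla'"
      unfolding projective_rel_def torsion_free_connections_def by blast+
    obtain \<Upsilon> where \<Upsilon>: "one_form A (topspace M) \<Upsilon>" and
      rel: "\<forall>U X Y. openin M U \<and> vector_field A U X \<and> vector_field A U Y \<longrightarrow>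
        vf_eq_on A U (nabla' U X Y)
          (\<lambda>c x. nabla0 U X Y c x + (\<Upsilon> c x \<bullet> X c x) *\<^sub>R Y c x + (\<Upsilon> c x \<bullet> Y c x) *\<^sub>R X c x)"
      using pr unfolding projective_rel_def by blast
    have rel: "vf_eq_on A U (nabla' U X Y)
          (\<lambda>c x. nabla0 U X Y c x + (\<Upsilon> c x \<bullet> X c x) *\<^sub>R Y c x + (\<Upsilon> c x \<bullet> Y c x) *\<^sub>R X c x)"
      if "vector_field A U X" "vector_field A U Y" for X Y
      by (rule rel[rule_format]) (simp add: that openU)
    obtain Q \<gamma> where Q: "\<And>a b. \<gamma> a b = - (Q a b - Q b a)"
      "\<And>a b i d. curvature nabla' c x a b i d =
        curvature nabla0 c x a b i d + (kronecker i a * Q b d - kronecker i b * Q a d) + \<gamma> a b * kronecker i d"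
      by (rule curvature_projective_change[OF N.conn N.tf nabla' \<Upsilon> rel x]) (assumption | rule that, assumption+)+
    have "weyl_decomposition (curvature nabla' c x) W (\<lambda>a b. P a b + Q a b) (\<lambda>a b. \<beta> a b + \<gamma> a b)"
      unfolding weyl_decomposition_def
    proof (intro conjI allI)
      show "completely_trace_free W" using W by (simp add: weyl_decomposition_def)
      show "\<beta> a b + \<gamma> a b = - (P a b + Q a b - (P b a + Q b a))" for a b
        using W Q(1)[of a b] by (simp add: weyl_decomposition_def)
      have R0: "curvature nabla0 c x a b i d =
          W a b i d + (kronecker i a * P b d - kronecker i b * P a d) + \<beta> a b * kronecker i d" for a b i d
        using W unfolding weyl_decomposition_def by blast
      show "curvature nabla' c x a b i d = W a b i d
          + (kronecker i a * (P b d + Q b d) - kronecker i b * (P a d + Q a d)) + (\<beta> a b + \<gamma> a b) * kronecker i d"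
        for a b i d
        unfolding Q(2) R0 by (simp only: algebra_simps)
    qed
    then show ?thesis by blast
  qed
  have "weyl_tensor p c x = W"
    unfolding weyl_tensor_def
  proof (rule the_equality)
    show "\<forall>nabla\<in>p. \<exists>P \<beta>. weyl_decomposition (curvature nabla c x) W P \<beta>" using all by blast
    show "W' = W" if "\<forall>nabla\<in>p. \<exists>P \<beta>. weyl_decomposition (curvature nabla c x) W' P \<beta>" for W'
      using that nabla all[OF nabla] weyl_decomposition_unique[OF card] by blast
  qed
  then show thesis using all[OF nabla] that by blast
qed

section \<open>Levi-Civita connections\<close>

lemma inner_matrix_axis:
  fixes G :: "real ^ 'n ^ 'n"
  shows "v \<bullet> (G *v axis e 1) = (\<Sum>i\<in>UNIV. v $ i * G $ i $ e)"
  by (simp add: matrix_vector_mult_basis column_def inner_vec_def)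

lemma inner_symmetric_matrix:
  fixes G :: "real ^ 'n ^ 'n"
  assumes "transpose G = G"
  shows "v \<bullet> (G *v w) = w \<bullet> (G *v v)"
  by (metis assms dot_lmul_matrix inner_commute transpose_matrix_vector)

text \<open>\<open>frechet_derivative\<close> is a choice among derivatives. Functions agreeing near
  the point have the same derivatives, so the choices coincide whether or not any derivative
  exists.\<close>

lemma (in manifold_chart) chart_deriv_cong:
  assumes "x \<in> U" "\<And>y. y \<in> U \<Longrightarrow> f y = f' y"
  shows "chart_deriv c f x = chart_deriv c f' x"
proof -
  have eq: "(f \<circ> chart_inv c) y = (f' \<circ> chart_inv c) y" if "y \<in> snd c ` U" for y
    using chart_inv_in[OF c that order_refl] assms(2) by simp
  have "(f \<circ> chart_inv c has_derivative F) (at (snd c x)) \<longleftrightarrow>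
      (f' \<circ> chart_inv c has_derivative F) (at (snd c x))" for F
    using has_derivative_transform_within_open[OF _ open_image imageI[OF assms(1)]] eq by metis
  then show ?thesis by (simp add: chart_deriv_def frechet_derivative_def)
qed

text \<open>Metric compatibility, used twice, expands the second derivative of g_de in directions b
  and a; its antisymmetric part in a and b is zero and equals the left side.\<close>

lemma (in manifold_chart) curvature_skew_adjoint:
  assumes g: "pseudo_riemannian_metric M A g" and lc: "levi_civita_connection M A g nabla"
    and x: "x \<in> U"
  shows "(\<Sum>i\<in>UNIV. curvature nabla c x a b i d * g c x $ i $ e)
    + (\<Sum>i\<in>UNIV. curvature nabla c x a b i e * g c x $ i $ d) = 0"
proof -
  have conn: "affine_connection M A nabla" "torsion_free M A nabla"
    using lc by (auto simp: levi_civita_connection_def)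
  interpret N: torsion_free_chart M A c nabla by unfold_locales (fact conn)+
  have gs: "smooth_on (snd c ` U) (g c \<circ> chart_inv c)"
    using g c unfolding pseudo_riemannian_metric_def by blast
  have sym: "transpose (g c y) = g c y" if "y \<in> U" for y
    using g c that unfolding pseudo_riemannian_metric_def by blast
  have compat: "chart_deriv c (\<lambda>y. Y c y \<bullet> (g c y *v Z c y)) y (X c y) =
      N.D X Y c y \<bullet> (g c y *v Z c y) + Y c y \<bullet> (g c y *v N.D X Z c y)"
    if "vector_field A U X" "vector_field A U Y" "vector_field A U Z" "y \<in> U" for X Y Z y
    by (rule lc[unfolded levi_civita_connection_def, THEN conjunct2, THEN conjunct2, rule_format])
      (use that c openU in simp_all)
  have fr: "\<partial> a c y = axis a 1" if "y \<in> U" for a y by (rule coord_field_chart[OF c that])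
  \<comment> \<open>The Christoffel symbols of the first kind, g(\<nabla>_b \<partial>_d,
    \<partial>_e).\<close>
  define q where "q b d e y = N.D (\<partial> b) (\<partial> d) c y \<bullet> (g c y *v axis e 1)" for b d e y
  have D1: "chart_deriv c (\<lambda>y. g c y $ d $ e) y (axis b 1) = q b d e y + q b e d y"
    if y: "y \<in> U" for b d e y
  proof -
    have "chart_deriv c (\<lambda>y. g c y $ d $ e) y = chart_deriv c (\<lambda>y. \<partial> d c y \<bullet> (g c y *v \<partial> e c y)) y"
      by (rule chart_deriv_cong[OF y]) (simp add: fr inner_axis' matrix_vector_mult_basis column_def)
    then show ?thesis
      using compat[of "\<partial> b" "\<partial> d" "\<partial> e" y] y
        inner_symmetric_matrix[OF sym[OF y], of "axis d 1" "N.D (\<partial> b) (\<partial> e) c y"]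
      by (simp add: fr q_def)
  qed
  have D2: "chart_deriv c (q b d e) x (axis a 1) =
      N.D (\<partial> a) (N.D (\<partial> b) (\<partial> d)) c x \<bullet> (g c x *v axis e 1)
      + N.D (\<partial> b) (\<partial> d) c x \<bullet> (g c x *v N.D (\<partial> a) (\<partial> e) c x)" for a b d e
  proof -
    have "chart_deriv c (q b d e) x = chart_deriv c (\<lambda>y. N.D (\<partial> b) (\<partial> d) c y \<bullet> (g c y *v \<partial> e c y)) x"
      by (rule chart_deriv_cong[OF x]) (simp add: fr q_def)
    then show ?thesis
      using compat[of "\<partial> a" "N.D (\<partial> b) (\<partial> d)" "\<partial> e" x] x by (simp add: fr)
  qed
  have q_diff: "q b d e \<circ> chart_inv c differentiable at (snd c x)" for b d e
  proof -
    let ?Y = "N.D (\<partial> b) (\<partial> d) c \<circ> chart_inv c"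
    have Y: "smooth_on (snd c ` (U \<inter> U)) ?Y"
      using N.D_frame[OF frame frame] c unfolding vector_field_def by blast
    have "linear (\<lambda>G :: real ^ 'n ^ 'n. G *v axis e 1)"
      by (auto intro!: linearI simp: matrix_vector_mult_add_rdistrib scaleR_matrix_vector_assoc)
    then have G: "smooth_on (snd c ` U) (\<lambda>y. (g c \<circ> chart_inv c) y *v axis e 1)"
      using smooth_on_bounded_linear[OF open_image _ gs] by (simp add: linear_conv_bounded_linear)
    have "(\<lambda>y. ?Y y \<bullet> ((g c \<circ> chart_inv c) y *v axis e 1)) differentiable at (snd c x)"
      using has_derivative_inner[OF smooth_on_has_derivative[OF Y, of "snd c x"]
          smooth_on_has_derivative[OF G, of "snd c x"]] x
      unfolding differentiable_def by blast
    then show ?thesis by (simp add: o_def q_def[abs_def])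
  qed
  \<comment> \<open>The second derivative of g_de, first along b and then along a, expressed through
    \<open>q\<close>.\<close>
  define S where "S a b = chart_deriv c (q b d e) x (axis a 1) + chart_deriv c (q b e d) x (axis a 1)" for a b
  have S: "S a b = S b a" for a b
  proof -
    let ?F = "(\<lambda>y. g c y $ d $ e) \<circ> chart_inv c"
    have "bounded_linear (\<lambda>G :: real ^ 'n ^ 'n. G $ d $ e)"
      using bounded_linear_compose[OF bounded_linear_vec_nth bounded_linear_vec_nth] .
    from smooth_on_bounded_linear[OF open_image this gs] have F: "C_k_on 2 (snd c ` U) ?F"
      by (simp add: smooth_on_def o_def)
    have "frechet_derivative (\<lambda>y. frechet_derivative ?F (at y) (axis b 1)) (at (snd c x)) (axis a 1) = S a b"
      for a b
    proof -
      have "((\<lambda>y. (q b d e \<circ> chart_inv c) y + (q b e d \<circ> chart_inv c) y) has_derivative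
          (\<lambda>v. chart_deriv c (q b d e) x v + chart_deriv c (q b e d) x v)) (at (snd c x))"
        unfolding chart_deriv_def
        by (rule has_derivative_add) (use q_diff frechet_derivative_works in blast)+
      then have "((\<lambda>y. frechet_derivative ?F (at y) (axis b 1)) has_derivative
          (\<lambda>v. chart_deriv c (q b d e) x v + chart_deriv c (q b e d) x v)) (at (snd c x))"
      proof (rule has_derivative_transform_within_open[OF _ open_image])
        show "snd c x \<in> snd c ` U" using x by simp
        fix y assume y: "y \<in> snd c ` U"
        have "frechet_derivative ?F (at y) (axis b 1) = chart_deriv c (\<lambda>y. g c y $ d $ e) (chart_inv c y) (axis b 1)"
          by (simp add: chart_deriv_def chart_chart_inv[OF y order_refl])
        then show "(q b d e \<circ> chart_inv c) y + (q b e d \<circ> chart_inv c) y = frechet_derivative ?F (at y) (axis b 1)"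
          using D1[OF chart_inv_in[OF c y order_refl]] by simp
      qed
      then show ?thesis by (simp add: frechet_derivative_eqI S_def)
    qed
    then show ?thesis
      using second_derivative_symmetric[OF open_image F imageI[OF x], of "axis b 1" "axis a 1"] by simp
  qed
  have swap: "v \<bullet> (g c x *v w) = w \<bullet> (g c x *v v)" for v w
    by (rule inner_symmetric_matrix[OF sym[OF x]])
  have "(N.D (\<partial> a) (N.D (\<partial> b) (\<partial> d)) c x - N.D (\<partial> b) (N.D (\<partial> a) (\<partial> d)) c x) \<bullet> (g c x *v axis e 1)
    + (N.D (\<partial> a) (N.D (\<partial> b) (\<partial> e)) c x - N.D (\<partial> b) (N.D (\<partial> a) (\<partial> e)) c x) \<bullet> (g c x *v axis d 1) = 0"
    \<comment> \<open>The products of two first covariant derivatives are interchanged by swapping a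
      and b, so they drop out.\<close>
    using S[of a b] unfolding S_def D2 inner_diff_left
    using swap[of "N.D (\<partial> b) (\<partial> d) c x" "N.D (\<partial> a) (\<partial> e) c x"]
      swap[of "N.D (\<partial> b) (\<partial> e) c x" "N.D (\<partial> a) (\<partial> d) c x"] by linarith
  then show ?thesis
    unfolding inner_matrix_axis by (simp add: N.curvature_frame[OF x])
qed

section \<open>Skew-adjoint endomorphisms and the conclusion\<close>

text \<open>\<open>B\<close> is \<open>R\<close> with its lower index raised by the inverse metric
  \<open>H\<close>; skew-adjointness of \<open>R\<close> turns into skewness of \<open>B\<close>.
  The parameter \<open>m\<close> allows all pairs of form indices to be treated at once.\<close>

lemma skew_adjoint_factorization:
  fixes G :: "real ^ 'n ^ 'n" and R :: "'m \<Rightarrow> 'n \<Rightarrow> 'n \<Rightarrow> real"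
  assumes G: "transpose G = G" "invertible G"
    and R: "\<And>m d e. (\<Sum>i\<in>UNIV. R m i d * G $ i $ e) + (\<Sum>i\<in>UNIV. R m i e * G $ i $ d) = 0"
  obtains B where "\<And>m i f. B m i f = - B m f i" "\<And>m i d. R m i d = (\<Sum>f\<in>UNIV. B m i f * G $ f $ d)"
proof -
  obtain H where H: "G ** H = mat 1" "H ** G = mat 1"
    using G(2) unfolding invertible_def by blast
  have "transpose (H ** G) = mat 1" by (simp add: H transpose_mat)
  then have "G ** transpose H = mat 1" by (simp add: matrix_transpose_mul G(1))
  then have HT: "transpose H = H"
    using matrix_mul_assoc[of H G "transpose H"] by (simp add: H)
  have neg: "X ** (- Y) = - (X ** Y)" "(- X) ** Y = - (X ** Y)" for X Y :: "real ^ 'n ^ 'n"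
    by (simp_all add: vec_eq_iff matrix_matrix_mult_def sum_negf)
  define Rm where "Rm m = (\<chi> i d. R m i d)" for m
  define B where "B m = Rm m ** H" for m
  have RG: "transpose (Rm m) ** G = - (G ** Rm m)" for m
  proof -
    have "(\<Sum>i\<in>UNIV. R m i d * G $ i $ e) = - (\<Sum>i\<in>UNIV. G $ d $ i * R m i e)" for d e
    proof -
      have "G $ d $ i = G $ i $ d" for i
        using arg_cong[OF G(1), of "\<lambda>X. X $ d $ i"] by (simp add: transpose_def)
      then show ?thesis using R[of m d e] by (simp add: mult.commute)
    qed
    then show ?thesis by (simp add: vec_eq_iff matrix_matrix_mult_def transpose_def Rm_def)
  qed
  have skew: "transpose (B m) = - B m" for m
  proof -
    have "transpose (B m) = H ** (transpose (Rm m) ** G) ** H"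
      by (simp add: B_def matrix_transpose_mul HT H flip: matrix_mul_assoc)
    also have "\<dots> = - (H ** G ** Rm m ** H)"
      unfolding RG by (simp add: matrix_mul_assoc neg)
    finally show ?thesis by (simp add: H B_def)
  qed
  have "B m $ i $ f = - B m $ f $ i" for m i f
    using arg_cong[OF skew[of m], of "\<lambda>X. X $ f $ i"] by (simp add: transpose_def)
  moreover have "R m i d = (\<Sum>f\<in>UNIV. B m $ i $ f * G $ f $ d)" for m i d
  proof -
    have "Rm m = B m ** G" by (simp add: B_def H flip: matrix_mul_assoc)
    then have "Rm m $ i $ d = (B m ** G) $ i $ d" by simp
    then show ?thesis by (simp add: Rm_def matrix_matrix_mult_def)
  qed
  ultimately show thesis by (rule that)
qed

lemma p_form_alternation:
  "p_form p k c x a = alternation (2 * k) (cyclic_contraction k (\<lambda>_. weyl_tensor p c x)) a / fact (2 * k)"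
  by (simp add: p_form_def alternation_def cyclic_contraction_def)

lemma sum_skew_mult_symmetric:
  fixes B G :: "'n::finite \<Rightarrow> 'n \<Rightarrow> real"
  assumes "\<And>i f. B i f = - B f i" "\<And>i f. G i f = G f i"
  shows "(\<Sum>i\<in>UNIV. \<Sum>f\<in>UNIV. B i f * G f i) = 0"
proof -
  have "(\<Sum>i\<in>UNIV. \<Sum>f\<in>UNIV. B i f * G f i) = (\<Sum>i\<in>UNIV. \<Sum>f\<in>UNIV. B f i * G i f)"
    by (rule sum.swap)
  also have "\<dots> = (\<Sum>i\<in>UNIV. \<Sum>f\<in>UNIV. - (B i f * G f i))"
    by (intro sum.cong refl, subst assms(1), subst assms(2)) simp
  finally show ?thesis by (simp add: sum_negf)
qed

theorem corollary4p2:
  fixes M :: "'a topology"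
    and A :: "('a, 'n::finite) chart set"
    and p :: "('a, 'n) conn set"
    and k :: nat
  assumes "CARD('n) \<ge> 2"
    and "smooth_manifold M A"
    and "projective_structure M A p"
    and "odd k"
    and "\<exists>c\<in>A. \<exists>x\<in>fst c. \<exists>a. p_form p k c x a \<noteq> 0"
  shows "\<not> (\<exists>g nabla. pseudo_riemannian_metric M A g \<and> levi_civita_connection M A g nabla \<and>
            nabla \<in> p)"
proof
  assume "\<exists>g nabla. pseudo_riemannian_metric M A g \<and> levi_civita_connection M A g nabla \<and> nabla \<in> p"
  then obtain g nabla where g: "pseudo_riemannian_metric M A g"
    and lc: "levi_civita_connection M A g nabla" and nabla: "nabla \<in> p" by blast
  obtain c x a where c: "c \<in> A" and x: "x \<in> fst c" and nz: "p_form p k c x a \<noteq> 0"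
    using assms(5) by blast
  interpret manifold_chart M A c by unfold_locales (fact assms c)+
  interpret N: torsion_free_chart M A c nabla
    using lc by unfold_locales (simp_all add: levi_civita_connection_def)
  let ?W = "weyl_tensor p c x" and ?R = "curvature nabla c x" and ?G = "g c x"
  obtain P \<beta> where dec: "weyl_decomposition ?R ?W P \<beta>"
    using weyl_tensor_decomposition[OF assms(1-3) c x nabla] .
  have tf: "(\<Sum>i\<in>UNIV. ?W a b i i) = 0" and \<beta>: "\<beta> a b = - (P a b - P b a)"
    and R: "?R a b i d = ?W a b i d + (kronecker i a * P b d - kronecker i b * P a d) + \<beta> a b * kronecker i d"
    for a b i d
    using dec unfolding weyl_decomposition_def completely_trace_free_def by blast+
  have Gsym: "transpose ?G = ?G" and Ginv: "invertible ?G"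
    using g c x unfolding pseudo_riemannian_metric_def by blast+
  let ?R' = "\<lambda>m. ?R (fst m) (snd m)"
  obtain B' where B': "\<And>m i f. B' m i f = - B' m f i"
    "\<And>m i d. ?R' m i d = (\<Sum>f\<in>UNIV. B' m i f * ?G $ f $ d)"
    by (rule skew_adjoint_factorization[where R = ?R', OF Gsym Ginv curvature_skew_adjoint[OF g lc x]]) (rule that, assumption+)
  define B where "B a b = B' (a, b)" for a b
  have B: "B a b i f = - B a b f i" for a b i f unfolding B_def by (rule B'(1))
  have RB: "?R a b i d = (\<Sum>f\<in>UNIV. B a b i f * ?G $ f $ d)" for a b i d
    using B'(2)[of "(a, b)"] by (simp only: B_def fst_conv snd_conv)
  have G: "?G $ i $ j = ?G $ j $ i" for i j
    using arg_cong[OF Gsym, of "\<lambda>X. X $ i $ j"] by (simp add: transpose_def)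
  have \<beta>0: "\<beta> a b = 0" for a b
  proof -
    have "0 = (\<Sum>i\<in>UNIV. ?R a b i i)"
      unfolding RB by (rule sum_skew_mult_symmetric[symmetric]) (rule B, rule G)
    \<comment> \<open>W has no trace, the two P terms together contribute one \<beta>, and the last
      term contributes n times \<beta>.\<close>
    also have "\<dots> = (1 + real CARD('n)) * \<beta> a b"
      by (simp add: R sum.distrib sum_subtractf sum_kronecker tf \<beta> algebra_simps)
    finally show ?thesis by (simp add: add_nonneg_eq_0_iff)
  qed
  then have P: "P a b = P b a" for a b using \<beta>[of a b] by simp
  have RW: "?R a b i d = ?W a b i d + (kronecker i a * P b d - kronecker i b * P a d)" for a b i d
    by (simp add: R \<beta>0)
  have "alternation (2 * k) (cyclic_contraction k (\<lambda>_. ?W)) a = 0"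
  proof (cases "k = 1")
    case True
    have "cyclic_contraction 1 (\<lambda>_. ?W) b = 0" for b
      unfolding cyclic_contraction_def
      by (subst sum_PiE_remove[of 0]) (simp_all add: tf)
    then show ?thesis by (simp add: True alternation_def)
  next
    case False
    then have "k \<ge> 2" using \<open>odd k\<close> by (cases k) auto
    \<comment> \<open>For symmetric P the cyclic sum of S is zero, so W inherits the Bianchi
      identity from R.\<close>
    have W: "?W a b i d + ?W b d i a + ?W d a i b = 0" for a b i d
      using N.curvature_Bianchi[OF x, of a b i d] P[of a b] P[of b d] P[of d a] by (simp add: RW)
    have "alternation (2 * k) (cyclic_contraction k (\<lambda>_. ?W)) a =
        alternation (2 * k) (cyclic_contraction k (\<lambda>_. ?R)) a"
      by (rule alternation_cyclic_contraction_replace[OF \<open>k \<ge> 2\<close> N.curvature_Bianchi[OF x] W RW])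
    also have "(\<lambda>_ :: nat. ?R) = (\<lambda>_ a b i d. \<Sum>f\<in>UNIV. B a b i f * ?G $ f $ d)"
      by (simp add: fun_eq_iff RB)
    also have "alternation (2 * k) (cyclic_contraction k \<dots>) a = 0"
      by (rule alternation_cyclic_contraction_skew_adjoint[OF B G \<open>odd k\<close>])
    finally show ?thesis .
  qed
  with nz show False by (simp add: p_form_alternation)
qed

end
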